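(* Let $I_T\subset K[x_1,\dots,x_s]$ be a simple toric ideal, let $\omega\subseteq\{1,\dots,s\}$, and let $I_{A_1}, I_{A_2}$ be two $T_\omega$-robust toric ideals, with associated isomorphisms $D_j:\operatorname{Ker}_{\mathbb Z}(T)\to\operatorname{Ker}_{\mathbb Z}(A_j)$, $j=1,2$. If $\mathcal M_1$ is a minimal Markov basis of $A_1$, then $$\mathcal M_2=\{D_2(\mathbf u)\mid \mathbf u\in\operatorname{Ker}_{\mathbb Z}(T)\text{ such that } D_1(\mathbf u)\in\mathcal M_1\}$$ is a minimal Markov basis of $A_2$. Thus there exists a one-to-one correspondence between the sets of all different minimal Markov bases of the two ideals. In particular, there exist one-to-one correspondences between the sets of indispensable elements of $A_1$ and $A_2$, and between the universal Markov bases of $A_1$ and $A_2$.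
   Context: $K$ is a field. For an integer matrix $M$ with $n$ columns, $\operatorname{Ker}_{\mathbb Z}(M)=\{\mathbf u\in\mathbb Z^n: M\mathbf u=0\}$, and the toric ideal $I_M\subset K[x_1,\dots,x_n]$ is generated by the binomials $x^{\mathbf u^+}-x^{\mathbf u^-}$, $\mathbf u\in\operatorname{Ker}_{\mathbb Z}(M)$, where $\mathbf u=\mathbf u^+-\mathbf u^-$ with $\mathbf u^\pm\in\mathbb N^n$ of disjoint supports. The matrices $A_1,A_2$ are assumed to satisfy $\operatorname{Ker}_{\mathbb Z}(A_j)\cap\mathbb N^{n_j}=\{\mathbf 0\}$, where $n_j$ is the number of columns of $A_j$ (i.e. $I_{A_j}$ is positively graded). Bouquets. Let $A=[\mathbf a_1,\dots,\mathbf a_n]\in\mathbb Z^{m\times n}$ have rank $r$. Its Gale transform is an $n\times(n-r)$ integer matrix whose columns form a basis of the lattice $\operatorname{Ker}_{\mathbb Z}(A)$; its rows are $\mathbf b_1,\dots,\mathbf b_n$. The vector $\mathbf a_i$ is free if $\mathbf b_i=\mathbf 0$. The bouquet graph has vertices $\mathbf a_1,\dots,\mathbf a_n$ and edges $\{\mathbf a_i,\mathbf a_j\}$ whenever $\mathbf b_i$ is a rational multiple of $\mathbf b_j$ and vice versa; its connected components are the bouquets. The free vectors, if any, form one bouquet, the free bouquet. A non-free bouquet is mixed if it contains an edge $\{\mathbf a_i,\mathbf a_j\}$ with $\mathbf b_i=\lambda\mathbf b_j$ for some $\lambda<0$; otherwise (isolated vertex, or $\lambda>0$ for all its edges) it is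 non-mixed. List the bouquets as $B_1,\dots,B_s$ and reorder the columns as $\mathbf a_{11},\dots,\mathbf a_{1k_1},\dots,\mathbf a_{s1},\dots,\mathbf a_{sk_s}$, with $\mathbf a_{i1},\dots,\mathbf a_{ik_i}$ the elements of $B_i$. Define $\mathbf c_{B_i}\in\mathbb Z^n$, supported on the positions $i1,\dots,ik_i$ with coordinates $c_{i1},\dots,c_{ik_i}$ there: if $B_i$ is free, $\mathbf c_{B_i}$ is any vector with support exactly $\{i1,\dots,ik_i\}$ and $c_{i1}>0$; if $B_i$ is non-free, choose an index $l$ with $(\mathbf b_{ij})_l\neq0$ for all $j$, put $g_l=\gcd((\mathbf b_{i1})_l,\dots,(\mathbf b_{ik_i})_l)$ and $c_{ij}=\varepsilon_{i1}(\mathbf b_{ij})_l/g_l$, where $\varepsilon_{i1}$ is the sign of $(\mathbf b_{i1})_l$. Let $\mathbf a_{B_i}=\sum_j c_{ij}\mathbf a_{ij}$ and $A_B=[\mathbf a_{B_1},\dots,\mathbf a_{B_s}]$; the bouquet ideal of $I_A$ is $I_{A_B}\subset K[x_1,\dots,x_s]$. The map $D(\mathbf u)=\sum_{i=1}^s u_i\mathbf c_{B_i}$ is an isomorphism $\operatorname{Ker}_{\mathbb Z}(A_B)\to\operatorname{Ker}_{\mathbb Z}(A)$ (known fact). A toric ideal is simple if every bouquet is a singleton. Given a simple toric ideal $I_T\subset K[x_1,\dots,x_s]$ and $\omega\subseteq\{1,\dots,s\}$, a toric ideal $I_A$ is $T_\omega$-robust if its bouquet ideal is $I_T$ (so $\operatorname{Ker}_{\mathbb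 Z}(A_B)=\operatorname{Ker}_{\mathbb Z}(T)$, the bouquet $B_i$ corresponding to $x_i$) and $\omega=\{i: B_i\text{ is non-mixed}\}$. For such ideals $I_{A_1},I_{A_2}$, $D_1,D_2$ denote the corresponding maps $D$. Markov bases. A Markov basis of $A$ is a finite subset $\mathcal M\subset\operatorname{Ker}_{\mathbb Z}(A)$ such that whenever $\mathbf w,\mathbf v\in\mathbb N^n$ and $\mathbf w-\mathbf v\in\operatorname{Ker}_{\mathbb Z}(A)$, there are $\mathbf u_1,\dots,\mathbf u_r$, each belonging to $\mathcal M$ up to sign, with $\mathbf w-\mathbf v=\sum_{i=1}^r\mathbf u_i$ and $\mathbf w-\sum_{i=1}^p\mathbf u_i\in\mathbb N^n$ for all $1\le p\le r$. It is minimal if no proper subset is a Markov basis. The universal Markov basis of $A$ is the union of all minimal Markov bases, and the set of indispensable elements of $A$ is the intersection of all minimal Markov bases, both up to identification of opposite vectors. *)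

theory Defs
  imports
    Jordan_Normal_Form.Matrix_Kernel
    "HOL-Library.Poly_Mapping"
begin

text \<open>
  Matrices and vectors have integer entries and are indexed from 0. The lattice of integer
  relations among the columns of \<open>A\<close> is \<open>mat_kernel A\<close>.
\<close>

section \<open>Toric ideals\<close>

text \<open>
  \<open>(nat \<Rightarrow>\<^sub>0 nat) \<Rightarrow>\<^sub>0 'k\<close> is the polynomial ring over \<open>'k\<close> in countably many variables;
  \<open>poly_ring n\<close> is its subring of polynomials in the variables with index below \<open>n\<close>.
\<close>

type_synonym 'k mpoly = "(nat \<Rightarrow>\<^sub>0 nat) \<Rightarrow>\<^sub>0 'k"

definition poly_ring :: "nat \<Rightarrow> 'k::field mpoly set" where
  "poly_ring n = {p. \<forall>m\<in>Poly_Mapping.keys p. Poly_Mapping.keys m \<subseteq> {..<n}}"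

text \<open>Since \<open>nat\<close> truncates, this is the monomial with exponent vector \<open>u\<^sup>+\<close>.\<close>

definition pos_monomial :: "int vec \<Rightarrow> 'k::field mpoly" where
  "pos_monomial u =
     Poly_Mapping.single (\<Sum>i<dim_vec u. Poly_Mapping.single i (nat (u $ i))) 1"

definition toric_binomials :: "int mat \<Rightarrow> 'k::field mpoly set" where
  "toric_binomials M = {pos_monomial u - pos_monomial (- u) | u. u \<in> mat_kernel M}"

definition toric_ideal :: "int mat \<Rightarrow> 'k::field mpoly set" where
  "toric_ideal M = {\<Sum>g\<in>F. q g * g | F q.
     finite F \<and> F \<subseteq> toric_binomials M \<and> (\<forall>g\<in>F. q g \<in> poly_ring (dim_col M))}"

section \<open>Bouquets\<close>

text \<open>
  The columns of \<open>G\<close> form a basis of the lattice \<open>mat_kernel A\<close>; hence their number is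
  necessarily \<open>dim_col A\<close> minus the rank of \<open>A\<close>.
\<close>

definition gale_transform :: "int mat \<Rightarrow> int mat \<Rightarrow> bool" where
  "gale_transform A G \<longleftrightarrow>
     dim_row G = dim_col A \<and>
     {G *\<^sub>v c | c. c \<in> carrier_vec (dim_col G)} = mat_kernel A \<and>
     (\<forall>c\<in>carrier_vec (dim_col G). G *\<^sub>v c = 0\<^sub>v (dim_row G) \<longrightarrow> c = 0\<^sub>v (dim_col G))"

definition rat_row :: "int mat \<Rightarrow> nat \<Rightarrow> rat vec" where
  "rat_row G i = map_vec rat_of_int (row G i)"

text \<open>
  The vertices of the bouquet graph are the column indices of \<open>A\<close> (so equal columns in
  different positions are different vertices), i.e. the row indices of \<open>G\<close>.
\<close>

definition bouquet_edges :: "int mat \<Rightarrow> (nat \<times> nat) set" where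
  "bouquet_edges G = {(i, j). i < dim_row G \<and> j < dim_row G \<and> i \<noteq> j \<and>
     (\<exists>q. rat_row G i = q \<cdot>\<^sub>v rat_row G j) \<and> (\<exists>q. rat_row G j = q \<cdot>\<^sub>v rat_row G i)}"

definition bouquets :: "int mat \<Rightarrow> nat set set" where
  "bouquets G = {..<dim_row G} // ((bouquet_edges G)\<^sup>* \<inter> {..<dim_row G} \<times> {..<dim_row G})"

definition free_bouquet :: "int mat \<Rightarrow> nat set \<Rightarrow> bool" where
  "free_bouquet G B \<longleftrightarrow> (\<forall>i\<in>B. row G i = 0\<^sub>v (dim_col G))"

definition mixed_bouquet :: "int mat \<Rightarrow> nat set \<Rightarrow> bool" where
  "mixed_bouquet G B \<longleftrightarrow> \<not> free_bouquet G B \<and>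
     (\<exists>i\<in>B. \<exists>j\<in>B. (i, j) \<in> bouquet_edges G \<and> (\<exists>q<0. rat_row G i = q \<cdot>\<^sub>v rat_row G j))"

text \<open>The free bouquet is neither mixed nor non-mixed.\<close>

definition non_mixed_bouquet :: "int mat \<Rightarrow> nat set \<Rightarrow> bool" where
  "non_mixed_bouquet G B \<longleftrightarrow> \<not> free_bouquet G B \<and> \<not> mixed_bouquet G B"

definition simple_toric :: "int mat \<Rightarrow> bool" where
  "simple_toric T \<longleftrightarrow> (\<exists>G. gale_transform T G \<and> (\<forall>B\<in>bouquets G. card B = 1))"

text \<open>
  \<open>bs ! i\<close> lists the indices \<open>i1, \<dots>, ik\<^sub>i\<close> of the \<open>i\<close>-th bouquet. The columns of \<open>A\<close> are
  not physically reordered.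
\<close>

definition bouquet_listing :: "int mat \<Rightarrow> nat list list \<Rightarrow> bool" where
  "bouquet_listing G bs \<longleftrightarrow>
     bij_betw (\<lambda>i. set (bs ! i)) {..<length bs} (bouquets G) \<and> (\<forall>b\<in>set bs. distinct b)"

definition bouquet_vector :: "int mat \<Rightarrow> nat list \<Rightarrow> int vec \<Rightarrow> bool" where
  "bouquet_vector G b c \<longleftrightarrow>
     (if free_bouquet G (set b)
      then c \<in> carrier_vec (dim_row G) \<and> {j. j < dim_row G \<and> c $ j \<noteq> 0} = set b \<and> c $ hd b > 0
      else \<exists>l<dim_col G. (\<forall>j\<in>set b. G $$ (j, l) \<noteq> 0) \<and>
             c = vec (dim_row G) (\<lambda>j. if j \<in> set b
                   then sgn (G $$ (hd b, l)) * (G $$ (j, l) div Gcd ((\<lambda>j. G $$ (j, l)) ` set b))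
                   else 0))"

text \<open>
  \<open>C\<close> has the vectors \<open>c\<^bsub>B\<^sub>i\<^esub>\<close> as columns. As \<open>c\<^bsub>B\<^sub>i\<^esub>\<close> is supported on \<open>B\<^sub>i\<close>, the \<open>i\<close>-th column
  of \<open>A * C\<close> is \<open>\<Sum>\<^sub>j c\<^sub>i\<^sub>j a\<^sub>i\<^sub>j\<close>, so \<open>A * C\<close> is the matrix \<open>A\<^sub>B\<close>, and the map \<open>D\<close> is \<open>(*\<^sub>v) C\<close>.
\<close>

definition bouquet_data :: "int mat \<Rightarrow> int mat \<Rightarrow> nat list list \<Rightarrow> int mat \<Rightarrow> bool" where
  "bouquet_data A G bs C \<longleftrightarrow>
     gale_transform A G \<and> bouquet_listing G bs \<and>
     C \<in> carrier_mat (dim_col A) (length bs) \<and>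
     (\<forall>i<length bs. bouquet_vector G (bs ! i) (col C i))"

definition bouquet_matrix :: "int mat \<Rightarrow> int mat \<Rightarrow> int mat" where
  "bouquet_matrix A C = A * C"

definition bouquet_map :: "int mat \<Rightarrow> int vec \<Rightarrow> int vec" where
  "bouquet_map C u = C *\<^sub>v u"

text \<open>
  \<open>I\<close> stands for the ideal of \<open>T\<close> in \<open>poly_ring s\<close>; the listing \<open>bs\<close> of the bouquets of \<open>A\<close>
  makes the \<open>i\<close>-th bouquet correspond to the variable \<open>x\<^sub>i\<close>.
\<close>

definition robust ::
  "'k::field mpoly set \<Rightarrow> nat \<Rightarrow> nat set \<Rightarrow>
   int mat \<Rightarrow> int mat \<Rightarrow> nat list list \<Rightarrow> int mat \<Rightarrow> bool" where
  "robust I s \<omega> A G bs C \<longleftrightarrow>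
     bouquet_data A G bs C \<and> length bs = s \<and>
     toric_ideal (bouquet_matrix A C) = I \<and>
     \<omega> = {i. i < s \<and> non_mixed_bouquet G (set (bs ! i))}"

section \<open>Markov bases\<close>

definition nat_vecs :: "nat \<Rightarrow> int vec set" where
  "nat_vecs n = {v \<in> carrier_vec n. 0\<^sub>v n \<le> v}"

definition vec_sum :: "nat \<Rightarrow> int vec list \<Rightarrow> int vec" where
  "vec_sum n us = foldr (+) us (0\<^sub>v n)"

text \<open>The empty list of moves is allowed; it is needed for \<open>w = v\<close>.\<close>

definition markov_basis :: "int mat \<Rightarrow> int vec set \<Rightarrow> bool" where
  "markov_basis A M \<longleftrightarrow>
     finite M \<and> M \<subseteq> mat_kernel A \<and>
     (\<forall>w\<in>nat_vecs (dim_col A). \<forall>v\<in>nat_vecs (dim_col A). w - v \<in> mat_kernel A \<longrightarrow>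
        (\<exists>us. set us \<subseteq> M \<union> uminus ` M \<and> w - v = vec_sum (dim_col A) us \<and>
           (\<forall>p\<in>{1..length us}. w - vec_sum (dim_col A) (take p us) \<in> nat_vecs (dim_col A))))"

definition minimal_markov_bases :: "int mat \<Rightarrow> int vec set set" where
  "minimal_markov_bases A = {M. markov_basis A M \<and> (\<forall>M'. M' \<subset> M \<longrightarrow> \<not> markov_basis A M')}"

text \<open>Opposite vectors are identified by passing to the classes \<open>{u, - u}\<close>.\<close>

definition sign_class :: "int vec \<Rightarrow> int vec set" where
  "sign_class u = {u, - u}"

definition universal_markov_basis :: "int mat \<Rightarrow> int vec set set" where
  "universal_markov_basis A = (\<Union>M\<in>minimal_markov_bases A. sign_class ` M)"

definition indispensable_elements :: "int mat \<Rightarrow> int vec set set" where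
  "indispensable_elements A =
     {X \<in> sign_class ` mat_kernel A. \<forall>M\<in>minimal_markov_bases A. X \<in> sign_class ` M}"

text \<open>
  The vectors of \<open>mat_kernel A\<^sub>2\<close> corresponding to the elements of \<open>X \<subseteq> mat_kernel A\<^sub>1\<close>; it also
  maps the sign class of \<open>D\<^sub>1 u\<close> to that of \<open>D\<^sub>2 u\<close>.
\<close>

definition transfer :: "int mat \<Rightarrow> int mat \<Rightarrow> int mat \<Rightarrow> int vec set \<Rightarrow> int vec set" where
  "transfer T C1 C2 X =
     {bouquet_map C2 u | u. u \<in> mat_kernel T \<and> bouquet_map C1 u \<in> X}"

end

theory Submission
  imports Defs
begin

text \<open>
  The notion of a Markov basis of \<open>A\<close> depends on two data only: the kernel \<open>L\<close> of \<open>T\<close>, and the set \<open>\<omega>\<close>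
  of non-mixed bouquets. To see this, identify the kernel of \<open>A\<close> with \<open>L\<close> by means of \<open>D\<close>. For a
  nonnegative \<open>w\<close>, the vectors of its fibre are the \<open>w - D u\<close> that are nonnegative, and at a position
  \<open>j\<close> of the bouquet \<open>i\<close> this says \<open>c\<^sub>j u\<^sub>i \<le> w\<^sub>j\<close>. In a non-mixed bouquet all \<open>c\<^sub>j\<close> are positive, so the
  conditions amount to one upper bound \<open>u\<^sub>i \<le> p\<^sub>i\<close>. In a mixed bouquet both signs occur and they amount
  to \<open>- q\<^sub>i \<le> u\<^sub>i \<le> p\<^sub>i\<close>. In the free bouquet \<open>u\<^sub>i = 0\<close> for all \<open>u\<close> in \<open>L\<close>, and any such bounds with
  \<open>p\<^sub>i, q\<^sub>i \<ge> 0\<close> hold. So every fibre is the intersection of \<open>L\<close> with a box containing \<open>0\<close>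
  (\<open>feasible_set_is_box\<close>), and conversely every such box arises from some \<open>w\<close>
  (\<open>box_is_feasible_set\<close>).
  
  Hence two robust ideals over the same \<open>T\<close> and \<open>\<omega>\<close> have the same fibres when these are viewed in \<open>L\<close>,
  and \<open>D\<^sub>2 D\<^sub>1\<^sup>-\<^sup>1\<close> matches paths in fibres of one with paths in fibres of the other. A set of
  moves is a Markov basis of \<open>A\<^sub>1\<close> if and only if its image is one of \<open>A\<^sub>2\<close>
  (\<open>robust_markov_basis_transfer\<close>). Minimality, the union and the intersection of all minimal Markov
  bases are transported along the bijection.
  
  Two ingredients support this. The hypothesis compares ideals, not kernels; the kernel is recovered
  by \<open>toric_ideal_determines_kernel\<close>. And \<open>D\<close> must be onto the kernel of \<open>A\<close> over the integers, which
  rests on the bouquet vectors being primitive (\<open>kernel_column_multiple\<close>, \<open>bouquet_map_image\<close>).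
\<close>

section \<open>Toric ideals determine the lattice of relations\<close>

text \<open>
  The ideal of \<open>M\<close> is homogeneous for the grading of monomials by \<open>M\<close> applied to the exponent
  vector, and the two monomials of a generating binomial have the same degree. So on every
  element of the ideal the coefficients belonging to one degree add up to \<open>0\<close>; these sums detect
  whether a binomial belongs to the ideal.
\<close>

definition multidegree :: "int mat \<Rightarrow> (nat \<Rightarrow>\<^sub>0 nat) \<Rightarrow> int vec" where
  "multidegree M m = M *\<^sub>v vec (dim_col M) (\<lambda>j. int (Poly_Mapping.lookup m j))"

definition fibre_sum :: "int mat \<Rightarrow> int vec \<Rightarrow> 'k::field mpoly \<Rightarrow> 'k" where
  "fibre_sum M d p = (\<Sum>m\<in>Poly_Mapping.keys p. Poly_Mapping.lookup p m when multidegree M m = d)"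

lemma multidegree_add: "multidegree M (a + b) = multidegree M a + multidegree M b"
proof -
  have "vec (dim_col M) (\<lambda>j. int (Poly_Mapping.lookup (a + b) j)) =
    vec (dim_col M) (\<lambda>j. int (Poly_Mapping.lookup a j)) +
    vec (dim_col M) (\<lambda>j. int (Poly_Mapping.lookup b j))"
    by (auto simp: lookup_add)
  then show ?thesis
    unfolding multidegree_def
    by (simp add: mult_add_distrib_mat_vec[of M "dim_row M" "dim_col M"])
qed

lemma fibre_sum_superset:
  assumes "finite S" "Poly_Mapping.keys p \<subseteq> S"
  shows "fibre_sum M d p = (\<Sum>m\<in>S. Poly_Mapping.lookup p m when multidegree M m = d)"
  unfolding fibre_sum_def
  by (rule sum.mono_neutral_left) (use assms in \<open>auto simp: in_keys_iff\<close>)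

lemma fibre_sum_add: "fibre_sum M d (p + q) = fibre_sum M d p + fibre_sum M d q"
proof -
  let ?S = "Poly_Mapping.keys p \<union> Poly_Mapping.keys q"
  show ?thesis
    using keys_add[of p q]
    by (simp add: fibre_sum_superset[of ?S] lookup_add when_add_distrib sum.distrib)
qed

lemma fibre_sum_zero: "fibre_sum M d 0 = 0"
  by (simp add: fibre_sum_def)

lemma fibre_sum_diff: "fibre_sum M d (p - q) = fibre_sum M d p - fibre_sum M d q"
  using fibre_sum_add[of M d "p - q" q] by simp

lemma fibre_sum_sum: "fibre_sum M d (\<Sum>x\<in>F. f x) = (\<Sum>x\<in>F. fibre_sum M d (f x))"
  by (induction F rule: infinite_finite_induct) (auto simp: fibre_sum_zero fibre_sum_add)

lemma fibre_sum_single: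
  "fibre_sum M d (Poly_Mapping.single m c) = (c when multidegree M m = d)"
  by (auto simp: fibre_sum_def)

text \<open>
  Each monomial of \<open>q\<close> contributes its coefficient twice, with opposite signs, in two monomials of
  equal degree.
\<close>

lemma fibre_sum_mult_binomial:
  fixes q :: "'k::field mpoly"
  assumes "multidegree M a = multidegree M b"
  shows "fibre_sum M d (q * (Poly_Mapping.single a 1 - Poly_Mapping.single b 1)) = 0"
proof -
  let ?g = "Poly_Mapping.single a 1 - Poly_Mapping.single b 1 :: 'k mpoly"
  have "q = (\<Sum>m\<in>Poly_Mapping.keys q. Poly_Mapping.single m (Poly_Mapping.lookup q m))"
    by (rule poly_mapping_eqI) (simp add: lookup_sum lookup_single when_def in_keys_iff)
  then have "q * ?g =
      (\<Sum>m\<in>Poly_Mapping.keys q. Poly_Mapping.single m (Poly_Mapping.lookup q m)) * ?g"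
    by (rule arg_cong)
  also have "\<dots> =
      (\<Sum>m\<in>Poly_Mapping.keys q. Poly_Mapping.single m (Poly_Mapping.lookup q m) * ?g)"
    by (rule sum_distrib_right)
  finally show ?thesis
    using assms
    by (simp add: fibre_sum_sum right_diff_distrib mult_single fibre_sum_diff fibre_sum_single
        multidegree_add)
qed

lemma pos_monomial_eq_single:
  obtains e where "pos_monomial u = Poly_Mapping.single e 1"
    and "vec (dim_vec u) (\<lambda>j. int (Poly_Mapping.lookup e j)) = vec (dim_vec u) (\<lambda>j. max 0 (u $ j))"
proof
  show "pos_monomial u = Poly_Mapping.single (\<Sum>i<dim_vec u. Poly_Mapping.single i (nat (u $ i))) 1"
    by (fact pos_monomial_def)
qed (auto simp: lookup_sum lookup_single when_def)

lemma exponent_difference: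
  fixes u :: "int vec"
  shows "vec (dim_vec u) (\<lambda>j. max 0 (u $ j)) - vec (dim_vec u) (\<lambda>j. max 0 ((- u) $ j)) = u"
  by (intro eq_vecI) auto

lemma toric_binomial_exponents:
  fixes M :: "int mat" 
  assumes u: "u \<in> carrier_vec (dim_col M)"
  obtains a b where "pos_monomial u - pos_monomial (- u) = (Poly_Mapping.single a 1 - Poly_Mapping.single b 1 :: 'k::field mpoly)"
    and "u \<in> mat_kernel M \<longleftrightarrow> multidegree M a = multidegree M b"
proof -
  obtain a where a: "(pos_monomial u :: 'k mpoly) = Poly_Mapping.single a 1"
    and la: "vec (dim_vec u) (\<lambda>j. int (Poly_Mapping.lookup a j)) = vec (dim_vec u) (\<lambda>j. max 0 (u $ j))"
    by (rule pos_monomial_eq_single)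
  obtain b where b: "(pos_monomial (-u) :: 'k mpoly) = Poly_Mapping.single b 1"
    and lb: "vec (dim_vec u) (\<lambda>j. int (Poly_Mapping.lookup b j)) = vec (dim_vec u) (\<lambda>j. max 0 ((-u) $ j))"
    by (rule pos_monomial_eq_single[of "-u"]) simp
  have du: "dim_vec u = dim_col M" using u by auto
  have "M *\<^sub>v u = multidegree M a - multidegree M b"
    unfolding multidegree_def using exponent_difference[of u] la lb du
    by (metis carrier_matI mult_minus_distrib_mat_vec vec_carrier)
  then have "M *\<^sub>v u = 0\<^sub>v (dim_row M) \<longleftrightarrow> multidegree M a = multidegree M b"
    by (auto simp: vec_eq_iff multidegree_def)
  then show thesis using that a b u by (simp add: mat_kernel_def)
qed

text \<open>
  If the binomial of \<open>u\<close> lies in the ideal, its coefficient sum in the degree of its first monomial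
  vanishes. As that monomial contributes \<open>1 \<noteq> 0\<close>, the second one must have the same degree, which
  says \<open>M u = 0\<close>.
\<close>

lemma binomial_in_toric_ideal_iff:
  fixes M :: "int mat"
  assumes u: "u \<in> carrier_vec (dim_col M)"
  shows "(pos_monomial u - pos_monomial (- u) :: 'k::field mpoly) \<in> toric_ideal M \<longleftrightarrow> u \<in> mat_kernel M"
proof
  assume "u \<in> mat_kernel M"
  then have "(pos_monomial u - pos_monomial (- u) :: 'k mpoly) \<in> toric_binomials M"
    by (auto simp: toric_binomials_def)
  moreover have "(1 :: 'k mpoly) \<in> poly_ring (dim_col M)"
    by (auto simp: poly_ring_def simp flip: single_one)
  ultimately show "(pos_monomial u - pos_monomial (- u) :: 'k mpoly) \<in> toric_ideal M"
    unfolding toric_ideal_def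
    by (intro CollectI exI[of _ "{pos_monomial u - pos_monomial (- u)}"] exI[of _ "\<lambda>_. 1"]) auto
next
  assume "(pos_monomial u - pos_monomial (- u) :: 'k mpoly) \<in> toric_ideal M"
  then obtain F and q :: "'k mpoly \<Rightarrow> 'k mpoly" where F: "F \<subseteq> toric_binomials M"
    and eq: "pos_monomial u - pos_monomial (- u) = (\<Sum>g\<in>F. q g * g)"
    unfolding toric_ideal_def by auto
  obtain a b where ab: "pos_monomial u - pos_monomial (- u) = (Poly_Mapping.single a 1 - Poly_Mapping.single b 1 :: 'k mpoly)"
    and iff: "u \<in> mat_kernel M \<longleftrightarrow> multidegree M a = multidegree M b"
    using toric_binomial_exponents[OF u] by metis
  have "fibre_sum M d (q g * g) = 0" if "g \<in> F" for g d
  proof -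
    obtain v where v: "v \<in> mat_kernel M" "g = pos_monomial v - pos_monomial (- v)"
      using \<open>g \<in> F\<close> F unfolding toric_binomials_def by blast
    then have "v \<in> carrier_vec (dim_col M)" by (simp add: mat_kernel_def)
    then obtain a b where "g = Poly_Mapping.single a 1 - Poly_Mapping.single b 1"
      and "multidegree M a = multidegree M b"
      using toric_binomial_exponents[of v M] v by metis
    then show ?thesis by (simp add: fibre_sum_mult_binomial)
  qed
  then have "fibre_sum M (multidegree M a) (\<Sum>g\<in>F. q g * g) = 0"
    by (simp add: fibre_sum_sum)
  then have "fibre_sum M (multidegree M a) (Poly_Mapping.single a 1 - Poly_Mapping.single b 1 :: 'k mpoly) = 0"
    using ab eq by simp
  then show "u \<in> mat_kernel M"
    by (auto simp: iff fibre_sum_diff fibre_sum_single when_def split: if_splits)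
qed

lemma toric_ideal_determines_kernel:
  fixes M N :: "int mat"
  assumes "(toric_ideal M :: 'k::field mpoly set) = toric_ideal N" and "dim_col M = dim_col N"
  shows "mat_kernel M = mat_kernel N"
proof -
  have "u \<in> mat_kernel M \<longleftrightarrow> u \<in> mat_kernel N" if "u \<in> carrier_vec (dim_col N)" for u
    using binomial_in_toric_ideal_iff[where 'k='k, of u M]
      binomial_in_toric_ideal_iff[where 'k='k, of u N] assms that by auto
  then show ?thesis using assms(2) unfolding mat_kernel_def by auto
qed

section \<open>Bouquets as classes of proportional rows\<close>

lemma equiv_bouquet_relation:
  "equiv {..<dim_row G} ((bouquet_edges G)\<^sup>* \<inter> {..<dim_row G} \<times> {..<dim_row G})"
proof (rule equivI)
  have "sym (bouquet_edges G)"
    by (auto simp: bouquet_edges_def sym_def)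
  then show "sym ((bouquet_edges G)\<^sup>* \<inter> {..<dim_row G} \<times> {..<dim_row G})"
    by (auto intro!: symI dest: symD[OF sym_rtrancl])
  show "trans ((bouquet_edges G)\<^sup>* \<inter> {..<dim_row G} \<times> {..<dim_row G})"
    by (auto simp: trans_def)
qed (auto simp: refl_on_def)

lemma Union_bouquets: "\<Union>(bouquets G) = {..<dim_row G}"
  unfolding bouquets_def by (rule Union_quotient[OF equiv_bouquet_relation])

lemma bouquets_disjoint: "B \<in> bouquets G \<Longrightarrow> B' \<in> bouquets G \<Longrightarrow> B = B' \<or> B \<inter> B' = {}"
  unfolding bouquets_def by (rule quotient_disj[OF equiv_bouquet_relation])

lemma bouquet_nonempty: "B \<in> bouquets G \<Longrightarrow> B \<noteq> {}"
  unfolding bouquets_def using equiv_bouquet_relation in_quotient_imp_non_empty by blast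

lemma bouquet_rows_proportional:
  assumes "B \<in> bouquets G" "i \<in> B" "j \<in> B"
  shows "\<exists>q. rat_row G i = q \<cdot>\<^sub>v rat_row G j"
proof -
  have "(i, j) \<in> (bouquet_edges G)\<^sup>*"
    using assms quotient_eq_iff[OF equiv_bouquet_relation, of B G B i j]
    by (auto simp: bouquets_def)
  then show ?thesis
  proof (induction rule: rtrancl_induct)
    case base
    show ?case by (rule exI[of _ 1]) simp
  next
    case (step k l)
    obtain q r where "rat_row G i = q \<cdot>\<^sub>v rat_row G k" "rat_row G k = r \<cdot>\<^sub>v rat_row G l"
      using step.IH step.hyps(2) unfolding bouquet_edges_def by blast
    then have "rat_row G i = (q * r) \<cdot>\<^sub>v rat_row G l"
      by (simp add: smult_smult_assoc)
    then show ?case by blast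
  qed
qed

lemma rat_row_eq_smultD:
  assumes "rat_row G i = q \<cdot>\<^sub>v rat_row G j" "i < dim_row G" "j < dim_row G" "l < dim_col G"
  shows "rat_of_int (G $$ (i, l)) = q * rat_of_int (G $$ (j, l))"
proof -
  have "rat_row G i $ l = (q \<cdot>\<^sub>v rat_row G j) $ l"
    using assms(1) by simp
  then show ?thesis
    using assms(2-4) by (simp add: rat_row_def)
qed

lemma rat_row_eq_smult_scalar_prod:
  assumes "rat_row G i = q \<cdot>\<^sub>v rat_row G j" "i < dim_row G" "j < dim_row G"
    and c: "c \<in> carrier_vec (dim_col G)"
  shows "rat_of_int (row G i \<bullet> c) = q * rat_of_int (row G j \<bullet> c)"
  using c rat_row_eq_smultD[OF assms(1-3)] assms(2,3)
  by (simp add: scalar_prod_def sum_distrib_left mult.assoc)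

text \<open>
  Coordinates of a kernel vector are scalar products with rows of the Gale transform, so on a
  bouquet they are in the same ratio as the entries in any column of the Gale transform.
\<close>

lemma gale_transform_proportional:
  assumes gale: "gale_transform A G" and B: "B \<in> bouquets G" "j \<in> B" "k \<in> B"
    and l: "l < dim_col G" and v: "v \<in> mat_kernel A"
  shows "G $$ (j, l) * v $ k = G $$ (k, l) * v $ j"
proof -
  obtain c where c: "c \<in> carrier_vec (dim_col G)" "v = G *\<^sub>v c"
    using gale v unfolding gale_transform_def by blast
  have jk: "j < dim_row G" "k < dim_row G"
    using B Union_bouquets[of G] by auto
  obtain q where q: "rat_row G j = q \<cdot>\<^sub>v rat_row G k"
    using bouquet_rows_proportional[OF B] by blast
  have "rat_of_int (G $$ (j, l) * v $ k) = rat_of_int (G $$ (k, l) * v $ j)"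
    using rat_row_eq_smultD[OF q jk l] rat_row_eq_smult_scalar_prod[OF q jk c(1)] c jk
    by simp
  then show ?thesis by (simp only: of_int_eq_iff)
qed

section \<open>The columns of the matrix of bouquet vectors\<close>

locale bouquet_config =
  fixes A G C :: "int mat" and bs :: "nat list list"
  assumes data: "bouquet_data A G bs C"
begin

abbreviation "n \<equiv> dim_col A"
abbreviation "s \<equiv> length bs"

text \<open>
  This is the kernel of \<open>A\<^sub>B\<close>. For a robust ideal it is the kernel of \<open>T\<close>, hence common to both
  ideals that are compared.
\<close>

definition bouquet_kernel :: "int vec set" where "bouquet_kernel = mat_kernel (A * C)"

lemma gale: "gale_transform A G"
  and C_carrier: "C \<in> carrier_mat n s"
  using data unfolding bouquet_data_def by blast+

lemma dim_G: "dim_row G = n"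
  using gale unfolding gale_transform_def by blast

lemma dim_C [simp]: "dim_row C = n" "dim_col C = s"
  using C_carrier by auto

lemma listing_image: "(\<lambda>i. set (bs ! i)) ` {..<s} = bouquets G"
  and listing_inj: "inj_on (\<lambda>i. set (bs ! i)) {..<s}"
  using data unfolding bouquet_data_def bouquet_listing_def bij_betw_def by blast+

lemma bouquet_in_bouquets: "i < s \<Longrightarrow> set (bs ! i) \<in> bouquets G"
  using listing_image by blast

lemma bouquet_bound: "i < s \<Longrightarrow> j \<in> set (bs ! i) \<Longrightarrow> j < n"
  using bouquet_in_bouquets Union_bouquets[of G] dim_G by auto

lemma hd_in_bouquet: "i < s \<Longrightarrow> hd (bs ! i) \<in> set (bs ! i)"
  using bouquet_nonempty[OF bouquet_in_bouquets] by auto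

lemma bouquet_exists:
  assumes "j < n"
  obtains i where "i < s" "j \<in> set (bs ! i)"
proof -
  obtain B where "B \<in> bouquets G" "j \<in> B"
    using assms Union_bouquets[of G] dim_G by auto
  then show thesis
    using that unfolding listing_image[symmetric] by blast
qed

lemma bouquet_unique:
  assumes "i < s" "k < s" "j \<in> set (bs ! i)" "j \<in> set (bs ! k)"
  shows "i = k"
proof -
  have "set (bs ! i) = set (bs ! k)"
    using assms bouquets_disjoint[OF bouquet_in_bouquets bouquet_in_bouquets, of i k] by blast
  then show ?thesis
    using assms inj_onD[OF listing_inj, of i k] by simp
qed

lemma bouquet_vector_col: "i < s \<Longrightarrow> bouquet_vector G (bs ! i) (col C i)"
  using data unfolding bouquet_data_def by blast

lemma free_column:
  assumes "i < s" "free_bouquet G (set (bs ! i))"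
  shows "{j. j < n \<and> C $$ (j, i) \<noteq> 0} = set (bs ! i)" and "C $$ (hd (bs ! i), i) > 0"
proof -
  have v: "{j. j < n \<and> col C i $ j \<noteq> 0} = set (bs ! i)" "col C i $ hd (bs ! i) > 0"
    using bouquet_vector_col[OF assms(1)] assms(2) by (simp_all only: bouquet_vector_def dim_G if_True)
  have c: "col C i $ j = C $$ (j, i)" if "j < n" for j
    using that assms(1) by simp
  have "{j. j < n \<and> C $$ (j, i) \<noteq> 0} = {j. j < n \<and> col C i $ j \<noteq> 0}"
    using c by (intro Collect_cong) auto
  also note v(1)
  finally show "{j. j < n \<and> C $$ (j, i) \<noteq> 0} = set (bs ! i)" .
  show "C $$ (hd (bs ! i), i) > 0"
    using v(2) c[OF bouquet_bound[OF assms(1) hd_in_bouquet[OF assms(1)]]] by simp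
qed

text \<open>
  On a non-free bouquet the bouquet vector is, up to the sign \<open>\<sigma>\<close> and the common divisor \<open>g\<close>, a
  column of the Gale transform. It is primitive; the last conjunct expresses this in the form in
  which integrality of the inverse of \<open>D\<close> uses it.
\<close>

lemma nonfree_column:
  assumes i: "i < s" and nf: "\<not> free_bouquet G (set (bs ! i))"
  shows "\<exists>l g \<sigma>. l < dim_col G \<and> g > 0 \<and> \<bar>\<sigma>\<bar> = 1 \<and>
    (\<forall>j\<in>set (bs ! i). G $$ (j, l) \<noteq> 0 \<and> g * C $$ (j, i) = \<sigma> * G $$ (j, l)) \<and>
    (\<forall>j<n. j \<notin> set (bs ! i) \<longrightarrow> C $$ (j, i) = 0) \<and>
    C $$ (hd (bs ! i), i) > 0 \<and>
    (\<forall>d m. (\<forall>j\<in>set (bs ! i). d dvd m * C $$ (j, i)) \<longrightarrow> d dvd m)"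
proof -
  let ?b = "set (bs ! i)"
  obtain l where l: "l < dim_col G" and nz: "\<forall>j\<in>?b. G $$ (j, l) \<noteq> 0"
    and c: "col C i = vec (dim_row G) (\<lambda>j. if j \<in> ?b
          then sgn (G $$ (hd (bs ! i), l)) * (G $$ (j, l) div Gcd ((\<lambda>j. G $$ (j, l)) ` ?b))
          else 0)"
    using bouquet_vector_col[OF i] nf by (auto simp: bouquet_vector_def)
  define g where "g = Gcd ((\<lambda>j. G $$ (j, l)) ` ?b)"
  define \<sigma> where "\<sigma> = sgn (G $$ (hd (bs ! i), l))"
  have h: "hd (bs ! i) \<in> ?b" by (rule hd_in_bouquet[OF i])
  have "g \<noteq> 0" using nz h by (auto simp: g_def)
  moreover have "g \<ge> 0" by (simp add: g_def)
  ultimately have g: "g > 0" by simp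
  have \<sigma>: "\<bar>\<sigma>\<bar> = 1" using nz h by (auto simp: \<sigma>_def sgn_if)
  have gdvd: "g dvd G $$ (j, l)" if "j \<in> ?b" for j
    using that by (simp add: g_def)
  have Cj: "C $$ (j, i) = (if j \<in> ?b then \<sigma> * (G $$ (j, l) div g) else 0)" if "j < n" for j
  proof -
    have "C $$ (j, i) = col C i $ j" using that i by simp
    then show ?thesis unfolding c using that dim_G by (simp add: g_def \<sigma>_def)
  qed
  have Cg: "g * C $$ (j, i) = \<sigma> * G $$ (j, l)" if "j \<in> ?b" for j
  proof -
    have "g * (\<sigma> * (G $$ (j, l) div g)) = \<sigma> * (g * (G $$ (j, l) div g))"
      by (rule mult.left_commute)
    then show ?thesis
      using that Cj[OF bouquet_bound[OF i that]] dvd_mult_div_cancel[OF gdvd[OF that]] by simp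
  qed
  have "g * C $$ (hd (bs ! i), i) > 0"
    unfolding Cg[OF h] \<sigma>_def mult.commute[of "sgn _"] abs_sgn[symmetric]
    using nz h by simp
  then have pos: "C $$ (hd (bs ! i), i) > 0" using g by (rule zero_less_mult_pos)
  have prim: "d dvd m" if d: "\<forall>j\<in>?b. d dvd m * C $$ (j, i)" for d m
  proof -
    have "d * g dvd m * G $$ (j, l)" if "j \<in> ?b" for j
    proof -
      have "d * g dvd m * C $$ (j, i) * g"
        using d that by (simp add: mult_dvd_mono)
      also have "m * C $$ (j, i) * g = \<sigma> * (m * G $$ (j, l))"
        unfolding mult.left_commute[of \<sigma>] Cg[OF that, symmetric] by (simp only: ac_simps)
      also have "\<dots> dvd m * G $$ (j, l)"
        using \<sigma> by (cases "\<sigma> = 1") (simp_all add: abs_if split: if_splits)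
      finally show ?thesis .
    qed
    then have "d * g dvd Gcd ((*) m ` (\<lambda>j. G $$ (j, l)) ` ?b)"
      by (auto intro!: Gcd_greatest)
    then have "d * g dvd m * g"
      by (simp add: Gcd_mult g_def)
    then show ?thesis using g by simp
  qed
  have "\<forall>j\<in>?b. G $$ (j, l) \<noteq> 0 \<and> g * C $$ (j, i) = \<sigma> * G $$ (j, l)"
    using nz Cg by blast
  moreover have "\<forall>j<n. j \<notin> ?b \<longrightarrow> C $$ (j, i) = 0"
    using Cj by simp
  moreover have "\<forall>d m. (\<forall>j\<in>?b. d dvd m * C $$ (j, i)) \<longrightarrow> d dvd m"
    using prim by blast
  ultimately show ?thesis using l g \<sigma> pos by blast
qed

lemma column_zero:
  assumes "i < s" "j < n" "j \<notin> set (bs ! i)"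
  shows "C $$ (j, i) = 0"
proof (cases "free_bouquet G (set (bs ! i))")
  case True
  then show ?thesis using free_column(1)[OF assms(1)] assms by blast
next
  case False
  then show ?thesis using nonfree_column[OF assms(1)] assms by blast
qed

lemma column_hd_pos:
  assumes "i < s"
  shows "C $$ (hd (bs ! i), i) > 0"
proof (cases "free_bouquet G (set (bs ! i))")
  case True
  then show ?thesis using free_column(2)[OF assms] by auto
next
  case False
  then show ?thesis using nonfree_column[OF assms(1)] assms by blast
qed

lemma bouquet_map_nth:
  assumes i: "i < s" and j: "j \<in> set (bs ! i)" and u: "u \<in> carrier_vec s"
  shows "(C *\<^sub>v u) $ j = C $$ (j, i) * u $ i"
proof -
  have jn: "j < n" by (rule bouquet_bound[OF i j])
  have "(C *\<^sub>v u) $ j = (\<Sum>k<s. C $$ (j, k) * u $ k)"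
    using jn u by (auto simp: scalar_prod_def atLeast0LessThan)
  also have "\<dots> = (\<Sum>k\<in>{i}. C $$ (j, k) * u $ k)"
    by (rule sum.mono_neutral_right)
      (use i j jn in \<open>auto intro!: column_zero dest: bouquet_unique[OF i _ j]\<close>)
  finally show ?thesis by simp
qed

text \<open>
  The entry at the head is positive by the choice of sign. An entry of the opposite sign would
  belong to a row that is a negative multiple of the head's row, so the two would span an edge that
  makes the bouquet mixed.
\<close>

lemma nonmixed_column_nonneg:
  assumes i: "i < s" and nm: "non_mixed_bouquet G (set (bs ! i))" and j: "j < n"
  shows "0 \<le> C $$ (j, i)"
proof (cases "j \<in> set (bs ! i)")
  case False
  then show ?thesis using column_zero[OF i j] by simp
next
  case True
  let ?h = "hd (bs ! i)"
  have nf: "\<not> free_bouquet G (set (bs ! i))" and nmix: "\<not> mixed_bouquet G (set (bs ! i))"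
    using nm by (auto simp: non_mixed_bouquet_def)
  have h: "?h \<in> set (bs ! i)" by (rule hd_in_bouquet[OF i])
  have bounds: "j < dim_row G" "?h < dim_row G"
    using j h bouquet_bound[OF i] dim_G by auto
  obtain l g \<sigma> where l: "l < dim_col G" and g: "g > 0" and nz: "G $$ (?h, l) \<noteq> 0"
    and Cg: "\<And>j. j \<in> set (bs ! i) \<Longrightarrow> g * C $$ (j, i) = \<sigma> * G $$ (j, l)"
    using h nonfree_column[OF i nf] by blast
  obtain q where q: "rat_row G j = q \<cdot>\<^sub>v rat_row G ?h"
    using bouquet_rows_proportional[OF bouquet_in_bouquets[OF i] True h] by blast
  note ql = rat_row_eq_smultD[OF q bounds l]
  have "q \<ge> 0"
  proof (rule ccontr)
    assume "\<not> q \<ge> 0"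
    then have neg: "q < 0" by simp
    then have "j \<noteq> ?h" using ql nz by auto
    then have "(j, ?h) \<in> bouquet_edges G"
      using bounds bouquet_rows_proportional[OF bouquet_in_bouquets[OF i]] True h
      by (auto simp: bouquet_edges_def)
    then show False using nmix nf True h q neg unfolding mixed_bouquet_def by blast
  qed
  have "rat_of_int (g * C $$ (j, i)) = q * rat_of_int (g * C $$ (?h, i))"
    unfolding Cg[OF True] Cg[OF h] using ql by simp
  also have "\<dots> \<ge> 0"
    using \<open>q \<ge> 0\<close> g column_hd_pos[OF i] by simp
  finally show ?thesis using g by (simp add: zero_le_mult_iff)
qed

lemma mixed_column_neg:
  assumes i: "i < s" and mixed: "mixed_bouquet G (set (bs ! i))"
  shows "\<exists>j<n. C $$ (j, i) < 0"
proof -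
  obtain j k q where jk: "j \<in> set (bs ! i)" "k \<in> set (bs ! i)" and "q < 0"
    and q: "rat_row G j = q \<cdot>\<^sub>v rat_row G k"
    using mixed unfolding mixed_bouquet_def by blast
  have nf: "\<not> free_bouquet G (set (bs ! i))"
    using mixed unfolding mixed_bouquet_def by blast
  have bounds: "j < dim_row G" "k < dim_row G"
    using jk bouquet_bound[OF i] dim_G by auto
  obtain l g \<sigma> where l: "l < dim_col G" and g: "g > 0" and \<sigma>: "\<bar>\<sigma>\<bar> = 1" and nz: "G $$ (k, l) \<noteq> 0"
    and Cg: "\<And>j. j \<in> set (bs ! i) \<Longrightarrow> g * C $$ (j, i) = \<sigma> * G $$ (j, l)"
    using jk nonfree_column[OF i nf] by blast
  have "rat_of_int (g * C $$ (j, i)) = q * rat_of_int (g * C $$ (k, i))"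
    unfolding Cg[OF jk(1)] Cg[OF jk(2)] using rat_row_eq_smultD[OF q bounds l] by simp
  then have "rat_of_int (C $$ (j, i)) = q * rat_of_int (C $$ (k, i))"
    using g by simp
  moreover have "C $$ (k, i) \<noteq> 0"
    using Cg[OF jk(2)] \<sigma> nz by auto
  ultimately have "C $$ (j, i) < 0 \<or> C $$ (k, i) < 0"
    using \<open>q < 0\<close> by (smt (verit) of_int_less_0_iff of_int_0_less_iff mult_neg_pos)
  then show ?thesis using bounds dim_G by auto
qed

section \<open>The map D is an isomorphism of kernels\<close>

lemma bouquet_kernel_carrier: "bouquet_kernel \<subseteq> carrier_vec s"
  by (auto simp: bouquet_kernel_def mat_kernel_def)

lemma bouquet_kernel_iff:
  assumes "u \<in> carrier_vec s"
  shows "u \<in> bouquet_kernel \<longleftrightarrow> C *\<^sub>v u \<in> mat_kernel A"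
proof -
  have "(A * C) *\<^sub>v u = A *\<^sub>v (C *\<^sub>v u)"
    using C_carrier assms by (intro assoc_mult_mat_vec[of A "dim_row A" n C s]) auto
  then show ?thesis
    using assms C_carrier by (simp add: bouquet_kernel_def mat_kernel_def)
qed

lemma kernel_free_zero:
  assumes i: "i < s" and free: "free_bouquet G (set (bs ! i))" and v: "v \<in> mat_kernel A"
    and j: "j \<in> set (bs ! i)"
  shows "v $ j = 0"
proof -
  obtain c where c: "c \<in> carrier_vec (dim_col G)" "v = G *\<^sub>v c"
    using gale v unfolding gale_transform_def by blast
  then show ?thesis
    using free j bouquet_bound[OF i j] by (simp add: free_bouquet_def dim_G)
qed

text \<open>
  Kernel vectors of \<open>A\<close> vanish at free indices, and the bouquet vector does not.
\<close>

lemma bouquet_kernel_free_zero: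
  assumes i: "i < s" and "free_bouquet G (set (bs ! i))" and u: "u \<in> bouquet_kernel"
  shows "u $ i = 0"
proof -
  have uc: "u \<in> carrier_vec s" using u bouquet_kernel_carrier by auto
  have "(C *\<^sub>v u) $ hd (bs ! i) = 0"
    using kernel_free_zero[OF assms(1,2) _ hd_in_bouquet[OF i]] u bouquet_kernel_iff[OF uc] by blast
  then show ?thesis
    using bouquet_map_nth[OF i hd_in_bouquet[OF i] uc] column_hd_pos[OF i] by simp
qed

lemma bouquet_map_inj: "inj_on ((*\<^sub>v) C) (carrier_vec s)"
proof (rule inj_onI)
  fix u v assume uv: "u \<in> carrier_vec s" "v \<in> carrier_vec s" and eq: "C *\<^sub>v u = C *\<^sub>v v"
  have "u $ i = v $ i" if i: "i < s" for i
    using bouquet_map_nth[OF i hd_in_bouquet[OF i]] uv column_hd_pos[OF i] eq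
    by (metis less_irrefl mult_cancel_left)
  then show "u = v" using uv by (intro eq_vecI) auto
qed

text \<open>
  For a non-free bouquet, proportionality gives \<open>c\<^sub>j v\<^sub>h = c\<^sub>h v\<^sub>j\<close> for the head \<open>h\<close> and all \<open>j\<close> in the
  bouquet. So \<open>c\<^sub>h\<close> divides all products \<open>c\<^sub>j v\<^sub>h\<close>, hence \<open>v\<^sub>h\<close> because the \<open>c\<^sub>j\<close> are coprime, and the
  quotient is the common integral factor.
\<close>

lemma kernel_column_multiple:
  assumes i: "i < s" and v: "v \<in> mat_kernel A"
  shows "\<exists>t. \<forall>j\<in>set (bs ! i). v $ j = C $$ (j, i) * t"
proof (cases "free_bouquet G (set (bs ! i))")
  case True
  then show ?thesis using kernel_free_zero[OF i True v] by (intro exI[of _ 0]) simp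
next
  case False
  let ?h = "hd (bs ! i)"
  have h: "?h \<in> set (bs ! i)" by (rule hd_in_bouquet[OF i])
  obtain l g \<sigma> where l: "l < dim_col G" and g: "g > 0"
    and Cg: "\<And>j. j \<in> set (bs ! i) \<Longrightarrow> g * C $$ (j, i) = \<sigma> * G $$ (j, l)"
    and prim: "\<And>d m. (\<And>j. j \<in> set (bs ! i) \<Longrightarrow> d dvd m * C $$ (j, i)) \<Longrightarrow> d dvd m"
    using nonfree_column[OF i False] by blast
  have cross: "C $$ (j, i) * v $ ?h = C $$ (?h, i) * v $ j" if j: "j \<in> set (bs ! i)" for j
  proof -
    have "g * (C $$ (j, i) * v $ ?h) = \<sigma> * (G $$ (j, l) * v $ ?h)"
      using Cg[OF j] by (simp flip: mult.assoc)
    also have "\<dots> = \<sigma> * (G $$ (?h, l) * v $ j)"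
      using gale_transform_proportional[OF gale bouquet_in_bouquets[OF i] j h l v] by simp
    also have "\<dots> = g * (C $$ (?h, i) * v $ j)"
      using Cg[OF h] by (simp flip: mult.assoc)
    finally show ?thesis using g by simp
  qed
  have "C $$ (?h, i) dvd v $ ?h"
  proof (rule prim)
    fix j assume "j \<in> set (bs ! i)"
    then have "v $ ?h * C $$ (j, i) = C $$ (?h, i) * v $ j"
      using cross by (simp add: mult.commute)
    then show "C $$ (?h, i) dvd v $ ?h * C $$ (j, i)" by simp
  qed
  then obtain t where t: "v $ ?h = C $$ (?h, i) * t" ..
  have "v $ j = C $$ (j, i) * t" if j: "j \<in> set (bs ! i)" for j
  proof -
    have "C $$ (?h, i) * v $ j = C $$ (?h, i) * (C $$ (j, i) * t)"
      unfolding cross[OF j, symmetric] t by (rule mult.left_commute)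
    moreover have "C $$ (?h, i) \<noteq> 0" using column_hd_pos[OF i] by simp
    ultimately show ?thesis using mult_left_cancel by blast
  qed
  then show ?thesis by blast
qed

lemma bouquet_map_image: "(*\<^sub>v) C ` bouquet_kernel = mat_kernel A"
proof
  show "(*\<^sub>v) C ` bouquet_kernel \<subseteq> mat_kernel A"
    using bouquet_kernel_iff bouquet_kernel_carrier by blast
  show "mat_kernel A \<subseteq> (*\<^sub>v) C ` bouquet_kernel"
  proof
    fix v assume v: "v \<in> mat_kernel A"
    obtain t where t: "\<And>i j. i < s \<Longrightarrow> j \<in> set (bs ! i) \<Longrightarrow> v $ j = C $$ (j, i) * t i"
      using kernel_column_multiple[OF _ v] by metis
    define u where "u = vec s t"
    have uc: "u \<in> carrier_vec s" by (simp add: u_def)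
    have vc: "v \<in> carrier_vec n" using v by (simp add: mat_kernel_def)
    have "C *\<^sub>v u = v"
    proof (rule eq_vecI)
      fix j assume "j < dim_vec v"
      then have "j < n" using vc by simp
      then obtain i where i: "i < s" "j \<in> set (bs ! i)" by (rule bouquet_exists)
      then show "(C *\<^sub>v u) $ j = v $ j"
        using bouquet_map_nth[OF i uc] t[OF i] by (simp add: u_def)
    qed (use vc in simp)
    then show "v \<in> (*\<^sub>v) C ` bouquet_kernel" using bouquet_kernel_iff[OF uc] v by (metis imageI)
  qed
qed

end

section \<open>Fibres are boxes in the common kernel\<close>

text \<open>
  The bounds are one-sided at \<open>\<omega>\<close> because a non-mixed bouquet has positive coefficients only, so
  that moving in the negative direction of its coordinate never leaves the nonnegative vectors.
\<close>

definition in_box :: "nat \<Rightarrow> nat set \<Rightarrow> (nat \<Rightarrow> int) \<Rightarrow> (nat \<Rightarrow> int) \<Rightarrow> int vec \<Rightarrow> bool" where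
  "in_box s \<omega> p q u \<longleftrightarrow> (\<forall>i<s. u $ i \<le> p i \<and> (i \<notin> \<omega> \<longrightarrow> - q i \<le> u $ i))"

lemma nat_vecs_iff: "v \<in> nat_vecs n \<longleftrightarrow> v \<in> carrier_vec n \<and> (\<forall>j<n. 0 \<le> v $ j)"
  by (auto simp: nat_vecs_def less_eq_vec_def)

lemma finitely_many_upper_bounds:
  fixes c w :: "'a \<Rightarrow> int"
  assumes "finite J" "J \<noteq> {}" "\<And>j. j \<in> J \<Longrightarrow> 0 < c j" "\<And>j. j \<in> J \<Longrightarrow> 0 \<le> w j"
  shows "\<exists>p\<ge>0. \<forall>t. (\<forall>j\<in>J. c j * t \<le> w j) \<longleftrightarrow> t \<le> p"
proof (intro exI[of _ "Min ((\<lambda>j. w j div c j) ` J)"] conjI allI)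
  show "0 \<le> Min ((\<lambda>j. w j div c j) ` J)"
    using assms by (auto simp: pos_imp_zdiv_nonneg_iff)
  fix t
  have "c j * t \<le> w j \<longleftrightarrow> t \<le> w j div c j" if "j \<in> J" for j
  proof
    assume "c j * t \<le> w j"
    then have "c j * t div c j \<le> w j div c j"
      using assms(3)[OF that] by (intro zdiv_mono1)
    then show "t \<le> w j div c j"
      using assms(3)[OF that] by simp
  next
    assume "t \<le> w j div c j"
    then have "c j * t \<le> c j * (w j div c j)"
      using assms(3)[OF that] by (intro mult_left_mono) auto
    also have "\<dots> \<le> w j"
      using assms(3)[OF that] by (metis mult_div_mod_eq le_add_same_cancel1 pos_mod_sign)
    finally show "c j * t \<le> w j" .
  qed
  then show "(\<forall>j\<in>J. c j * t \<le> w j) \<longleftrightarrow> t \<le> Min ((\<lambda>j. w j div c j) ` J)"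
    using assms(1,2) by auto
qed

context bouquet_config
begin

definition nonmixed :: "nat set" where
  "nonmixed = {i. i < s \<and> non_mixed_bouquet G (set (bs ! i))}"

text \<open>
  A bouquet outside \<open>\<omega>\<close> is mixed or free. In the mixed case the negative entry gives the lower
  bound of the box; in the free case the coordinate is always \<open>0\<close> and lies within any bounds
  \<open>- q \<le> 0 \<le> p\<close>.
\<close>

lemma bouquet_trichotomy [consumes 1, case_names nonmixed mixed free]:
  assumes i: "i < s"
  obtains (nonmixed) "i \<in> nonmixed" "\<And>j. j < n \<Longrightarrow> 0 \<le> C $$ (j, i)"
  | (mixed) "i \<notin> nonmixed" "\<exists>j<n. C $$ (j, i) < 0"
  | (free) "i \<notin> nonmixed" "\<And>u. u \<in> bouquet_kernel \<Longrightarrow> u $ i = 0"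
proof (cases "non_mixed_bouquet G (set (bs ! i))")
  case True
  then show thesis
    using i nonmixed nonmixed_column_nonneg[OF i True] unfolding nonmixed_def by blast
next
  case False
  then have "i \<notin> nonmixed" by (simp add: nonmixed_def)
  moreover have "free_bouquet G (set (bs ! i)) \<or> mixed_bouquet G (set (bs ! i))"
    using False by (auto simp: non_mixed_bouquet_def)
  ultimately show thesis
    using mixed free mixed_column_neg[OF i] bouquet_kernel_free_zero[OF i] by blast
qed

lemma feasible_iff:
  assumes w: "w \<in> nat_vecs n" and u: "u \<in> carrier_vec s"
  shows "w - C *\<^sub>v u \<in> nat_vecs n \<longleftrightarrow> (\<forall>i<s. \<forall>j<n. C $$ (j, i) * u $ i \<le> w $ j)"
proof -
  have wn: "0 \<le> w $ j" if "j < n" for j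
    using w that by (simp add: nat_vecs_iff)
  have car: "w - C *\<^sub>v u \<in> carrier_vec n" by (rule carrier_vecI) simp
  have "(w - C *\<^sub>v u) $ j = w $ j - (C *\<^sub>v u) $ j" if "j < n" for j
    using that by (intro index_minus_vec) simp
  then have "w - C *\<^sub>v u \<in> nat_vecs n \<longleftrightarrow> (\<forall>j<n. (C *\<^sub>v u) $ j \<le> w $ j)"
    unfolding nat_vecs_iff using car by (metis diff_ge_0_iff_ge)
  also have "\<dots> \<longleftrightarrow> (\<forall>i<s. \<forall>j\<in>set (bs ! i). C $$ (j, i) * u $ i \<le> w $ j)"
  proof (intro iffI allI impI ballI)
    fix i j assume "\<forall>j<n. (C *\<^sub>v u) $ j \<le> w $ j" and i: "i < s" and j: "j \<in> set (bs ! i)"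
    then show "C $$ (j, i) * u $ i \<le> w $ j"
      unfolding bouquet_map_nth[OF i j u, symmetric] using bouquet_bound[OF i j] by blast
  next
    fix j assume all: "\<forall>i<s. \<forall>j\<in>set (bs ! i). C $$ (j, i) * u $ i \<le> w $ j" and "j < n"
    from \<open>j < n\<close> obtain i where i: "i < s" and j: "j \<in> set (bs ! i)" by (rule bouquet_exists)
    show "(C *\<^sub>v u) $ j \<le> w $ j"
      unfolding bouquet_map_nth[OF i j u] using all i j by blast
  qed
  also have "\<dots> \<longleftrightarrow> (\<forall>i<s. \<forall>j<n. C $$ (j, i) * u $ i \<le> w $ j)"
  proof (intro iffI allI impI ballI)
    fix i j assume all: "\<forall>i<s. \<forall>j\<in>set (bs ! i). C $$ (j, i) * u $ i \<le> w $ j"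
      and i: "i < s" and j: "j < n"
    show "C $$ (j, i) * u $ i \<le> w $ j"
    proof (cases "j \<in> set (bs ! i)")
      case True
      then show ?thesis using all i by blast
    next
      case False
      then show ?thesis using column_zero[OF i j] wn[OF j] by simp
    qed
  next
    fix i j assume all: "\<forall>i<s. \<forall>j<n. C $$ (j, i) * u $ i \<le> w $ j"
      and i: "i < s" and j: "j \<in> set (bs ! i)"
    then show "C $$ (j, i) * u $ i \<le> w $ j" using bouquet_bound[OF i j] by blast
  qed
  finally show ?thesis .
qed

text \<open>
  Positive entries of the column give upper bounds on \<open>u\<^sub>i\<close>, negative ones give lower bounds, and in
  each group the sharpest bound is \<open>Min\<close> of finitely many quotients rounded down. These are
  nonnegative because \<open>w\<close> is.
\<close>

lemma column_constraint_is_interval: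
  assumes i: "i < s" and w: "w \<in> nat_vecs n"
  shows "\<exists>p\<ge>0. \<exists>q\<ge>0. \<forall>u\<in>bouquet_kernel. (\<forall>j<n. C $$ (j, i) * u $ i \<le> w $ j) \<longleftrightarrow>
    u $ i \<le> p \<and> (i \<notin> nonmixed \<longrightarrow> - q \<le> u $ i)"
proof -
  have wn: "0 \<le> w $ j" if "j < n" for j
    using w that by (simp add: nat_vecs_iff)
  define P where "P = {j. j < n \<and> 0 < C $$ (j, i)}"
  define N where "N = {j. j < n \<and> C $$ (j, i) < 0}"
  have "hd (bs ! i) \<in> P"
    using column_hd_pos[OF i] bouquet_bound[OF i hd_in_bouquet[OF i]] by (simp add: P_def)
  then have "P \<noteq> {}" by blast
  have "\<exists>p\<ge>0. \<forall>t. (\<forall>j\<in>P. C $$ (j, i) * t \<le> w $ j) \<longleftrightarrow> t \<le> p"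
    by (rule finitely_many_upper_bounds[OF _ \<open>P \<noteq> {}\<close>]) (simp_all add: P_def wn)
  then obtain p where p: "p \<ge> 0" "\<And>t. (\<forall>j\<in>P. C $$ (j, i) * t \<le> w $ j) \<longleftrightarrow> t \<le> p"
    by blast
  have split: "(\<forall>j<n. C $$ (j, i) * t \<le> w $ j) \<longleftrightarrow>
      t \<le> p \<and> (\<forall>j\<in>N. C $$ (j, i) * t \<le> w $ j)" for t
  proof -
    have "C $$ (j, i) * t \<le> w $ j" if "j < n" "j \<notin> P" "j \<notin> N" for j
    proof -
      have "C $$ (j, i) = 0" using that by (auto simp: P_def N_def)
      then show ?thesis using wn[OF that(1)] by simp
    qed
    then have "(\<forall>j<n. C $$ (j, i) * t \<le> w $ j) \<longleftrightarrow>
      (\<forall>j\<in>P. C $$ (j, i) * t \<le> w $ j) \<and> (\<forall>j\<in>N. C $$ (j, i) * t \<le> w $ j)"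
      unfolding P_def N_def by blast
    then show ?thesis using p(2) by blast
  qed
  from i show ?thesis
  proof (cases rule: bouquet_trichotomy)
    case nonmixed
    have "N = {}" using nonmixed(2) by (auto simp: N_def not_less[symmetric])
    then show ?thesis
      using p(1) nonmixed(1) split by (intro exI[of _ p] conjI exI[of _ 0]) simp_all
  next
    case mixed
    then have "N \<noteq> {}" unfolding N_def by blast
    have "\<exists>q\<ge>0. \<forall>t. (\<forall>j\<in>N. - C $$ (j, i) * t \<le> w $ j) \<longleftrightarrow> t \<le> q"
      by (rule finitely_many_upper_bounds[OF _ \<open>N \<noteq> {}\<close>]) (simp_all add: N_def wn)
    then obtain q where q: "q \<ge> 0" "\<And>t. (\<forall>j\<in>N. - C $$ (j, i) * t \<le> w $ j) \<longleftrightarrow> t \<le> q"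
      by blast
    have "(\<forall>j\<in>N. C $$ (j, i) * t \<le> w $ j) \<longleftrightarrow> - q \<le> t" for t
      using q(2)[of "- t"] by (simp add: minus_le_iff)
    then show ?thesis
      using p(1) q(1) mixed(1) split by (intro exI[of _ p] conjI exI[of _ q]) blast+
  next
    case free
    have iff: "(\<forall>j<n. C $$ (j, i) * u $ i \<le> w $ j) \<longleftrightarrow>
        u $ i \<le> p \<and> (i \<notin> nonmixed \<longrightarrow> - 0 \<le> u $ i)" if "u \<in> bouquet_kernel" for u
      using free(2)[OF that] wn p(1) by simp
    show ?thesis
      by (intro exI[of _ p] exI[of _ 0] conjI ballI p(1) order_refl iff)
  qed
qed

lemma feasible_set_is_box:
  assumes w: "w \<in> nat_vecs n"
  shows "\<exists>p q. (\<forall>i<s. 0 \<le> p i \<and> 0 \<le> q i) \<and>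
    (\<forall>u\<in>bouquet_kernel. w - C *\<^sub>v u \<in> nat_vecs n \<longleftrightarrow> in_box s nonmixed p q u)"
proof -
  have "\<forall>i. \<exists>p q. i < s \<longrightarrow> 0 \<le> p \<and> 0 \<le> q \<and>
      (\<forall>u\<in>bouquet_kernel. (\<forall>j<n. C $$ (j, i) * u $ i \<le> w $ j) \<longleftrightarrow>
        u $ i \<le> p \<and> (i \<notin> nonmixed \<longrightarrow> - q \<le> u $ i))"
    using column_constraint_is_interval[OF _ w] by blast
  then obtain p q where pq: "\<And>i. i < s \<Longrightarrow> 0 \<le> p i \<and> 0 \<le> q i \<and>
      (\<forall>u\<in>bouquet_kernel. (\<forall>j<n. C $$ (j, i) * u $ i \<le> w $ j) \<longleftrightarrow>
        u $ i \<le> p i \<and> (i \<notin> nonmixed \<longrightarrow> - q i \<le> u $ i))"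
    by metis
  have "w - C *\<^sub>v u \<in> nat_vecs n \<longleftrightarrow> in_box s nonmixed p q u" if u: "u \<in> bouquet_kernel" for u
  proof -
    have "u \<in> carrier_vec s" using u bouquet_kernel_carrier by blast
    then show ?thesis
      unfolding feasible_iff[OF w \<open>u \<in> carrier_vec s\<close>] in_box_def using pq u by blast
  qed
  then show ?thesis using pq by blast
qed

text \<open>
  At a position with coefficient \<open>c > 0\<close> the value \<open>c p\<^sub>i\<close> encodes the upper bound \<open>p\<^sub>i\<close>, and at one
  with \<open>c < 0\<close> the value \<open>- c q\<^sub>i\<close> encodes the lower bound \<open>- q\<^sub>i\<close>. A mixed bouquet has positions of
  both kinds, so its two bounds can be prescribed independently.
\<close>

lemma box_is_feasible_set:
  assumes pq: "\<forall>i<s. 0 \<le> p i \<and> 0 \<le> q i"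
  shows "\<exists>w\<in>nat_vecs n. \<forall>u\<in>bouquet_kernel. w - C *\<^sub>v u \<in> nat_vecs n \<longleftrightarrow> in_box s nonmixed p q u"
proof -
  have "\<forall>j. \<exists>i. j < n \<longrightarrow> i < s \<and> j \<in> set (bs ! i)"
    by (blast elim: bouquet_exists)
  then obtain \<beta> where \<beta>: "\<And>j. j < n \<Longrightarrow> \<beta> j < s \<and> j \<in> set (bs ! \<beta> j)"
    by metis
  \<comment> \<open>The maximum selects the term that is nonnegative for the sign of the coefficient.\<close>
  define w where
    "w = vec n (\<lambda>j. max (C $$ (j, \<beta> j) * p (\<beta> j)) (- C $$ (j, \<beta> j) * q (\<beta> j)))"
  have wj: "w $ j = max (C $$ (j, i) * p i) (- C $$ (j, i) * q i)"
    if "i < s" "j \<in> set (bs ! i)" for i j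
    using that \<beta>[of j] bouquet_bound[OF that] bouquet_unique[of "\<beta> j" i j] by (simp add: w_def)
  have wn: "0 \<le> w $ j" if "j < n" for j
  proof -
    have "0 \<le> p (\<beta> j)" "0 \<le> q (\<beta> j)" using pq \<beta>[OF that] by auto
    then have "0 \<le> C $$ (j, \<beta> j) * p (\<beta> j) \<or> 0 \<le> - C $$ (j, \<beta> j) * q (\<beta> j)"
      by (cases "0 \<le> C $$ (j, \<beta> j)") (simp_all add: mult_nonpos_nonneg)
    then show ?thesis using that by (auto simp: w_def le_max_iff_disj)
  qed
  then have w: "w \<in> nat_vecs n" by (simp add: nat_vecs_iff w_def)
  have entry: "C $$ (j, i) * t \<le> w $ j \<longleftrightarrow>
      (C $$ (j, i) > 0 \<longrightarrow> t \<le> p i) \<and> (C $$ (j, i) < 0 \<longrightarrow> - q i \<le> t)"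
    if i: "i < s" and j: "j < n" for i j t
  proof (cases "C $$ (j, i)" "0::int" rule: linorder_cases)
    case equal
    then show ?thesis using wn[OF j] by simp
  next
    case less
    have jb: "j \<in> set (bs ! i)" using column_zero[OF i j] less by auto
    have "C $$ (j, i) * p i \<le> 0" "0 \<le> - C $$ (j, i) * q i"
      using less pq i by (auto simp: mult_le_0_iff)
    then have "w $ j = C $$ (j, i) * - q i" using wj[OF i jb] by simp
    then show ?thesis using less by (simp only: mult_le_cancel_left_neg) auto
  next
    case greater
    have jb: "j \<in> set (bs ! i)" using column_zero[OF i j] greater by auto
    have "0 \<le> C $$ (j, i) * p i" "- C $$ (j, i) * q i \<le> 0"
      using greater pq i by auto
    then have "w $ j = C $$ (j, i) * p i" using wj[OF i jb] by simp
    then show ?thesis using greater by (simp only: mult_le_cancel_left_pos) auto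
  qed
  have "w - C *\<^sub>v u \<in> nat_vecs n \<longleftrightarrow> in_box s nonmixed p q u" if u: "u \<in> bouquet_kernel" for u
  proof -
    have uc: "u \<in> carrier_vec s" using u bouquet_kernel_carrier by blast
    have "(\<forall>j<n. C $$ (j, i) * u $ i \<le> w $ j) \<longleftrightarrow>
        u $ i \<le> p i \<and> (i \<notin> nonmixed \<longrightarrow> - q i \<le> u $ i)" if i: "i < s" for i
    proof -
      have pos: "\<exists>j<n. C $$ (j, i) > 0"
        using column_hd_pos[OF i] bouquet_bound[OF i hd_in_bouquet[OF i]] by blast
      have e: "(\<forall>j<n. C $$ (j, i) * u $ i \<le> w $ j) \<longleftrightarrow>
          u $ i \<le> p i \<and> ((\<exists>j<n. C $$ (j, i) < 0) \<longrightarrow> - q i \<le> u $ i)"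
        using entry[OF i] pos by blast
      from i show ?thesis
      proof (cases rule: bouquet_trichotomy)
        case nonmixed
        then have "\<not> (\<exists>j<n. C $$ (j, i) < 0)" by (meson not_less)
        then show ?thesis using e nonmixed(1) by blast
      next
        case mixed
        then show ?thesis using e by blast
      next
        case free
        have "u $ i \<le> p i" "- q i \<le> u $ i" using free(2)[OF u] pq i by auto
        then show ?thesis using e by blast
      qed
    qed
    then show ?thesis unfolding feasible_iff[OF w uc] in_box_def by blast
  qed
  then show ?thesis using w by blast
qed

end

section \<open>Transport of Markov bases\<close>

lemma vec_sum_carrier:
  "set xs \<subseteq> carrier_vec n \<Longrightarrow> vec_sum n xs \<in> carrier_vec n"
  by (induction xs) (auto simp: vec_sum_def)

lemma mult_mat_vec_sum:
  assumes "C \<in> carrier_mat n s" "set xs \<subseteq> carrier_vec s"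
  shows "vec_sum n (map ((*\<^sub>v) C) xs) = C *\<^sub>v vec_sum s xs"
  using assms(2)
proof (induction xs)
  case Nil
  show ?case using assms(1) by (auto simp: vec_sum_def)
next
  case (Cons x xs)
  then have "vec_sum s xs \<in> carrier_vec s" by (intro vec_sum_carrier) simp
  then show ?case
    using Cons assms(1) by (simp add: vec_sum_def mult_add_distrib_mat_vec)
qed

lemma mult_mat_vec_uminus:
  assumes "C \<in> carrier_mat n s" "u \<in> carrier_vec s"
  shows "C *\<^sub>v (- u) = - (C *\<^sub>v (u :: 'a :: comm_ring_1 vec))"
  using assms by (intro eq_vecI) (auto simp: scalar_prod_def sum_negf)

lemma mat_kernel_uminus:
  assumes "u \<in> mat_kernel (T :: int mat)"
  shows "- u \<in> mat_kernel T"
  using assms mult_mat_vec_uminus[of T "dim_row T" "dim_col T" u]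
  by (auto simp: mat_kernel_def)

lemma mat_kernel_vec_sum:
  assumes "set xs \<subseteq> mat_kernel (T :: int mat)"
  shows "vec_sum (dim_col T) xs \<in> mat_kernel T"
  using assms
proof (induction xs)
  case Nil
  show ?case by (auto simp: vec_sum_def mat_kernel_def)
next
  case (Cons x xs)
  then have "x \<in> mat_kernel T" "vec_sum (dim_col T) xs \<in> mat_kernel T" by auto
  then show ?case
    using mult_add_distrib_mat_vec[of T "dim_row T" "dim_col T"]
    by (auto simp: vec_sum_def mat_kernel_def)
qed

text \<open>
  The hypothesis \<open>fibre\<close> says that a partial sum \<open>x\<close> of moves keeps \<open>w2 - C2 x\<close> nonnegative exactly
  when it keeps \<open>w1 - C1 x\<close> nonnegative. So a path in the fibre of \<open>w1\<close>, pulled back to the kernel of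
  \<open>T\<close> and pushed forward by \<open>C2\<close>, is a path in the fibre of \<open>w2\<close>.
\<close>

lemma markov_basis_transfer:
  fixes T A1 A2 C1 C2 :: "int mat"
  assumes C1: "C1 \<in> carrier_mat (dim_col A1) (dim_col T)"
    and C2: "C2 \<in> carrier_mat (dim_col A2) (dim_col T)"
    and K1: "(*\<^sub>v) C1 ` mat_kernel T = mat_kernel A1"
    and K2: "(*\<^sub>v) C2 ` mat_kernel T = mat_kernel A2"
    and inj1: "inj_on ((*\<^sub>v) C1) (mat_kernel T)"
    and fibre: "\<And>w2. w2 \<in> nat_vecs (dim_col A2) \<Longrightarrow> \<exists>w1\<in>nat_vecs (dim_col A1). \<forall>u\<in>mat_kernel T.
      w1 - C1 *\<^sub>v u \<in> nat_vecs (dim_col A1) \<longleftrightarrow> w2 - C2 *\<^sub>v u \<in> nat_vecs (dim_col A2)"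
    and N: "N \<subseteq> mat_kernel T"
    and markov: "markov_basis A1 ((*\<^sub>v) C1 ` N)"
  shows "markov_basis A2 ((*\<^sub>v) C2 ` N)"
  unfolding markov_basis_def
proof (intro conjI ballI impI)
  let ?L = "mat_kernel T"
  have LC: "?L \<subseteq> carrier_vec (dim_col T)" by (auto simp: mat_kernel_def)
  have "finite ((*\<^sub>v) C1 ` N)" using markov by (simp add: markov_basis_def)
  then have "finite N" using inj1 N by (meson finite_imageD inj_on_subset)
  then show "finite ((*\<^sub>v) C2 ` N)" by simp
  show "(*\<^sub>v) C2 ` N \<subseteq> mat_kernel A2" using N K2 by blast
  have signs: "(*\<^sub>v) C ` N \<union> uminus ` (*\<^sub>v) C ` N = (*\<^sub>v) C ` (N \<union> uminus ` N)"
    if "C \<in> carrier_mat m (dim_col T)" for C m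
  proof -
    have "uminus ` (*\<^sub>v) C ` N = (*\<^sub>v) C ` uminus ` N"
      unfolding image_image using N LC mult_mat_vec_uminus[OF that]
      by (intro image_cong) auto
    then show ?thesis by (simp add: image_Un)
  qed
  fix w v
  assume w: "w \<in> nat_vecs (dim_col A2)" and v: "v \<in> nat_vecs (dim_col A2)"
    and wv: "w - v \<in> mat_kernel A2"
  obtain u where u: "u \<in> ?L" "w - v = C2 *\<^sub>v u" using wv K2 by blast
  obtain w1 where w1: "w1 \<in> nat_vecs (dim_col A1)"
    and iff: "\<And>u. u \<in> ?L \<Longrightarrow>
      w1 - C1 *\<^sub>v u \<in> nat_vecs (dim_col A1) \<longleftrightarrow> w - C2 *\<^sub>v u \<in> nat_vecs (dim_col A2)"
    using fibre[OF w] by blast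
  have "w - C2 *\<^sub>v u = v"
    unfolding u(2)[symmetric] using w v by (intro eq_vecI) (auto simp: nat_vecs_iff)
  then have v1: "w1 - C1 *\<^sub>v u \<in> nat_vecs (dim_col A1)" using iff[OF u(1)] v by simp
  have d1: "w1 - (w1 - C1 *\<^sub>v u) = C1 *\<^sub>v u"
    using w1 C1 by (intro eq_vecI) (auto simp: nat_vecs_iff)
  have "C1 *\<^sub>v u \<in> mat_kernel A1" using u(1) K1 by blast
  then obtain us where us: "set us \<subseteq> (*\<^sub>v) C1 ` N \<union> uminus ` (*\<^sub>v) C1 ` N"
    and sum: "C1 *\<^sub>v u = vec_sum (dim_col A1) us"
    and path: "\<And>k. k \<in> {1..length us} \<Longrightarrow>
      w1 - vec_sum (dim_col A1) (take k us) \<in> nat_vecs (dim_col A1)"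
    using markov w1 v1 d1 unfolding markov_basis_def by metis
  have "us \<in> lists ((*\<^sub>v) C1 ` (N \<union> uminus ` N))"
    using us unfolding signs[OF C1] by auto
  then obtain xs where xs: "set xs \<subseteq> N \<union> uminus ` N" and us_eq: "us = map ((*\<^sub>v) C1) xs"
    unfolding lists_image by auto
  have xsL: "set xs \<subseteq> ?L" using xs N mat_kernel_uminus by blast
  have takeL: "vec_sum (dim_col T) (take k xs) \<in> ?L" for k
    using xsL set_take_subset[of k xs] by (intro mat_kernel_vec_sum) auto
  have take1: "vec_sum (dim_col A1) (take k us) = C1 *\<^sub>v vec_sum (dim_col T) (take k xs)" for k
    unfolding us_eq take_map
    by (rule mult_mat_vec_sum[OF C1]) (use xsL LC set_take_subset[of k xs] in blast)
  have take2: "vec_sum (dim_col A2) (take k (map ((*\<^sub>v) C2) xs)) = C2 *\<^sub>v vec_sum (dim_col T) (take k xs)" for k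
    unfolding take_map
    by (rule mult_mat_vec_sum[OF C2]) (use xsL LC set_take_subset[of k xs] in blast)
  have "C1 *\<^sub>v u = C1 *\<^sub>v vec_sum (dim_col T) xs"
    using sum take1[of "length xs"] us_eq by simp
  then have "u = vec_sum (dim_col T) xs"
    using inj_onD[OF inj1 _ u(1)] takeL[of "length xs"] by simp
  then have "w - v = vec_sum (dim_col A2) (map ((*\<^sub>v) C2) xs)"
    using u(2) take2[of "length xs"] by simp
  moreover have "set (map ((*\<^sub>v) C2) xs) \<subseteq> (*\<^sub>v) C2 ` N \<union> uminus ` (*\<^sub>v) C2 ` N"
    unfolding signs[OF C2] using xs by auto
  moreover have "w - vec_sum (dim_col A2) (take k (map ((*\<^sub>v) C2) xs)) \<in> nat_vecs (dim_col A2)"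
    if "k \<in> {1..length (map ((*\<^sub>v) C2) xs)}" for k
    using path[of k] that us_eq iff[OF takeL[of k]] unfolding take1 take2 by simp
  ultimately show "\<exists>us. set us \<subseteq> (*\<^sub>v) C2 ` N \<union> uminus ` (*\<^sub>v) C2 ` N \<and>
      w - v = vec_sum (dim_col A2) us \<and>
      (\<forall>k\<in>{1..length us}. w - vec_sum (dim_col A2) (take k us) \<in> nat_vecs (dim_col A2))"
    by blast
qed

section \<open>Correspondences of minimal Markov bases\<close>

lemma bij_betw_image_minimal:
  assumes f: "bij_betw f A B"
    and P: "\<And>M. P M \<Longrightarrow> M \<subseteq> A" and Q: "\<And>N. Q N \<Longrightarrow> N \<subseteq> B"
    and PQ: "\<And>M. M \<subseteq> A \<Longrightarrow> P M \<longleftrightarrow> Q (f ` M)"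
  shows "bij_betw ((`) f) {M. P M \<and> (\<forall>M'. M' \<subset> M \<longrightarrow> \<not> P M')} {N. Q N \<and> (\<forall>N'. N' \<subset> N \<longrightarrow> \<not> Q N')}"
    (is "bij_betw _ ?X ?Y")
proof (rule bij_betw_subset[OF bij_betw_Pow[OF f]])
  show "?X \<subseteq> Pow A" using P by blast
  have inj: "inj_on f A" and surj: "f ` A = B" using f by (auto simp: bij_betw_def)
  have minimal: "(\<forall>N'. N' \<subset> f ` M \<longrightarrow> \<not> Q N') \<longleftrightarrow> (\<forall>M'. M' \<subset> M \<longrightarrow> \<not> P M')" if M: "M \<subseteq> A" for M
  proof (intro iffI allI impI)
    fix M' assume "\<forall>N'. N' \<subset> f ` M \<longrightarrow> \<not> Q N'" and "M' \<subset> M"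
    moreover have "f ` M' \<subset> f ` M"
      using image_strict_mono[OF inj_on_subset[OF inj M] \<open>M' \<subset> M\<close>] .
    ultimately show "\<not> P M'" using PQ[of M'] M by blast
  next
    fix N' assume *: "\<forall>M'. M' \<subset> M \<longrightarrow> \<not> P M'" and N': "N' \<subset> f ` M"
    then obtain M' where M': "M' \<subseteq> M" "N' = f ` M'" by (meson psubsetE subset_imageE)
    then show "\<not> Q N'" using * N' PQ[of M'] M by blast
  qed
  have mem: "f ` M \<in> ?Y \<longleftrightarrow> M \<in> ?X" if "M \<subseteq> A" for M
    using PQ[OF that] minimal[OF that] by simp
  show "(`) f ` ?X = ?Y"
  proof (intro equalityI subsetI)
    fix N assume "N \<in> (`) f ` ?X"
    then obtain M where "M \<in> ?X" "N = f ` M" by (rule imageE)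
    moreover from this have "M \<subseteq> A" using P by simp
    ultimately show "N \<in> ?Y" using mem by simp
  next
    fix N assume N: "N \<in> ?Y"
    then have "N \<subseteq> f ` A" using Q surj by simp
    then obtain M where "M \<subseteq> A" "N = f ` M" by (meson subset_imageE)
    then show "N \<in> (`) f ` ?X" using N mem[of M] by (simp only: image_eqI)
  qed
qed

text \<open>
  The map \<open>\<phi>\<close> plays the role of \<open>D\<^sub>2 D\<^sub>1\<^sup>-\<^sup>1\<close>, and \<open>\<tau>\<close> that of the transfer map, which agrees with
  the image under \<open>\<phi>\<close> on sets of kernel vectors only. As \<open>\<phi>\<close> is odd, it maps sign classes to sign
  classes; so it carries the whole family of minimal Markov bases modulo sign to the corresponding
  family, and with it the union and the intersection of the family.
\<close>

context
  fixes A1 A2 :: "int mat" and \<phi> :: "int vec \<Rightarrow> int vec" and \<tau> :: "int vec set \<Rightarrow> int vec set"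
  assumes \<phi>: "bij_betw \<phi> (mat_kernel A1) (mat_kernel A2)"
    and \<phi>_uminus: "\<And>v. v \<in> mat_kernel A1 \<Longrightarrow> \<phi> (- v) = - \<phi> v"
    and markov: "\<And>M. M \<subseteq> mat_kernel A1 \<Longrightarrow> markov_basis A1 M \<longleftrightarrow> markov_basis A2 (\<phi> ` M)"
    and \<tau>: "\<And>X. X \<subseteq> mat_kernel A1 \<Longrightarrow> \<tau> X = \<phi> ` X"
begin

lemma minimal_bases_subset: "M \<in> minimal_markov_bases A \<Longrightarrow> M \<subseteq> mat_kernel A"
  by (simp add: minimal_markov_bases_def markov_basis_def)

lemma image_minimal_bases:
  "bij_betw ((`) \<phi>) (minimal_markov_bases A1) (minimal_markov_bases A2)"
  unfolding minimal_markov_bases_def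
proof (rule bij_betw_image_minimal[OF \<phi>])
  show "M \<subseteq> mat_kernel A1" if "markov_basis A1 M" for M
    using that by (simp add: markov_basis_def)
  show "M \<subseteq> mat_kernel A2" if "markov_basis A2 M" for M
    using that by (simp add: markov_basis_def)
qed (rule markov)

lemma sign_class_subset: "v \<in> mat_kernel A \<Longrightarrow> sign_class v \<subseteq> mat_kernel A"
  by (simp add: sign_class_def mat_kernel_uminus)

lemma image_sign_classes:
  assumes "M \<subseteq> mat_kernel A1"
  shows "(`) \<phi> ` sign_class ` M = sign_class ` \<phi> ` M"
  unfolding image_image
proof (rule image_cong[OF refl])
  fix v assume "v \<in> M"
  then have "\<phi> (- v) = - \<phi> v" using assms \<phi>_uminus by blast
  then show "\<phi> ` sign_class v = sign_class (\<phi> v)" by (simp add: sign_class_def)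
qed

lemma image_sign_class_bases:
  "(`) ((`) \<phi>) ` (`) sign_class ` minimal_markov_bases A1 = (`) sign_class ` minimal_markov_bases A2"
proof -
  have "(`) ((`) \<phi>) ` (`) sign_class ` minimal_markov_bases A1 =
      (`) sign_class ` (`) \<phi> ` minimal_markov_bases A1"
    unfolding image_image[of "(`) ((`) \<phi>)"] image_image[of "(`) sign_class"]
    using image_sign_classes[OF minimal_bases_subset] by (intro image_cong) auto
  then show ?thesis using image_minimal_bases by (simp add: bij_betw_def)
qed

lemma transfer_minimal_bases:
  "bij_betw \<tau> (minimal_markov_bases A1) (minimal_markov_bases A2)"
proof -
  have "\<tau> M = \<phi> ` M" if "M \<in> minimal_markov_bases A1" for M
    by (rule \<tau>[OF minimal_bases_subset[OF that]])
  then show ?thesis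
    using image_minimal_bases bij_betw_cong[of "minimal_markov_bases A1" \<tau> "(`) \<phi>"] by simp
qed

lemma transfer_sign_classes:
  assumes "\<And>X. X \<in> S1 \<Longrightarrow> X \<subseteq> mat_kernel A1" and "(`) \<phi> ` S1 = S2"
  shows "bij_betw \<tau> S1 S2"
proof -
  have "bij_betw ((`) \<phi>) S1 S2"
    by (rule bij_betw_subset[OF bij_betw_Pow[OF \<phi>]]) (use assms in auto)
  then show ?thesis using bij_betw_cong[of S1 \<tau> "(`) \<phi>"] \<tau> assms(1) by blast
qed

lemma transfer_sign_class_bases:
  "bij_betw ((`) \<tau>) ((`) sign_class ` minimal_markov_bases A1)
    ((`) sign_class ` minimal_markov_bases A2)"
proof -
  let ?F = "(`) sign_class ` minimal_markov_bases A1"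
  have sub: "S \<subseteq> Pow (mat_kernel A1)" if "S \<in> ?F" for S
    using that sign_class_subset minimal_bases_subset by blast
  have "bij_betw ((`) ((`) \<phi>)) ?F ((`) sign_class ` minimal_markov_bases A2)"
    by (rule bij_betw_subset[OF bij_betw_Pow[OF bij_betw_Pow[OF \<phi>]] _ image_sign_class_bases])
      (use sub in blast)
  moreover have "\<tau> ` S = (`) \<phi> ` S" if "S \<in> ?F" for S
    using sub[OF that] \<tau> by (intro image_cong) auto
  ultimately show ?thesis
    using bij_betw_cong[of ?F "(`) \<tau>" "(`) ((`) \<phi>)"] by blast
qed

lemma transfer_universal:
  "bij_betw \<tau> (universal_markov_basis A1) (universal_markov_basis A2)"
proof (rule transfer_sign_classes)
  show "X \<subseteq> mat_kernel A1" if "X \<in> universal_markov_basis A1" for X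
    using that sign_class_subset minimal_bases_subset
    unfolding universal_markov_basis_def by blast
  have "(`) \<phi> ` \<Union>((`) sign_class ` minimal_markov_bases A1) =
      \<Union>((`) ((`) \<phi>) ` (`) sign_class ` minimal_markov_bases A1)"
    by (rule image_Union)
  then show "(`) \<phi> ` universal_markov_basis A1 = universal_markov_basis A2"
    unfolding image_sign_class_bases universal_markov_basis_def .
qed

lemma transfer_indispensable:
  "bij_betw \<tau> (indispensable_elements A1) (indispensable_elements A2)"
proof (rule transfer_sign_classes)
  show "X \<subseteq> mat_kernel A1" if "X \<in> indispensable_elements A1" for X
    using that sign_class_subset unfolding indispensable_elements_def by blast
  have inj: "inj_on ((`) \<phi>) (Pow (mat_kernel A1))"
    using bij_betw_Pow[OF \<phi>] by (simp add: bij_betw_def)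
  have mem: "\<phi> ` X \<in> sign_class ` \<phi> ` M \<longleftrightarrow> X \<in> sign_class ` M"
    if "X \<in> sign_class ` mat_kernel A1" "M \<in> minimal_markov_bases A1" for X M
  proof -
    have "M \<subseteq> mat_kernel A1" by (rule minimal_bases_subset[OF that(2)])
    then have "sign_class ` M \<subseteq> Pow (mat_kernel A1)" "X \<in> Pow (mat_kernel A1)"
      using that(1) sign_class_subset by blast+
    then show ?thesis
      unfolding image_sign_classes[OF \<open>M \<subseteq> mat_kernel A1\<close>, symmetric]
      using inj by (intro inj_on_image_mem_iff)
  qed
  have bases: "minimal_markov_bases A2 = (`) \<phi> ` minimal_markov_bases A1"
    using image_minimal_bases by (simp add: bij_betw_def)
  have classes: "sign_class ` mat_kernel A2 = (`) \<phi> ` sign_class ` mat_kernel A1"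
    using image_sign_classes[of "mat_kernel A1"] \<phi> by (simp add: bij_betw_def)
  show "(`) \<phi> ` indispensable_elements A1 = indispensable_elements A2"
  proof (intro equalityI subsetI)
    fix Y assume "Y \<in> (`) \<phi> ` indispensable_elements A1"
    then obtain X where X: "X \<in> sign_class ` mat_kernel A1" "Y = \<phi> ` X"
      and "\<forall>M\<in>minimal_markov_bases A1. X \<in> sign_class ` M"
      unfolding indispensable_elements_def by fast
    then have "\<forall>M\<in>minimal_markov_bases A1. Y \<in> sign_class ` \<phi> ` M"
      using mem[OF X(1)] by simp
    then show "Y \<in> indispensable_elements A2"
      unfolding indispensable_elements_def bases classes using X by simp
  next
    fix Y assume "Y \<in> indispensable_elements A2"
    then have Y: "Y \<in> (`) \<phi> ` sign_class ` mat_kernel A1"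
      and all: "\<forall>M\<in>minimal_markov_bases A1. Y \<in> sign_class ` \<phi> ` M"
      unfolding indispensable_elements_def bases classes by simp_all
    from Y obtain X where X: "Y = \<phi> ` X" "X \<in> sign_class ` mat_kernel A1"
      by (rule imageE)
    have "\<forall>M\<in>minimal_markov_bases A1. X \<in> sign_class ` M"
      using mem[OF X(2)] all X(1) by simp
    then show "Y \<in> (`) \<phi> ` indispensable_elements A1"
      unfolding indispensable_elements_def using X by simp
  qed
qed

end

section \<open>Robust toric ideals\<close>

lemma robust_bouquet_map:
  fixes I :: "'k::field mpoly set"
  assumes "I = toric_ideal T" and "robust I (dim_col T) \<omega> A G bs C"
  shows "bouquet_config A G C bs" and "length bs = dim_col T"
    and "bouquet_config.bouquet_kernel A C = mat_kernel T"
    and "bouquet_config.nonmixed G bs = \<omega>"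
proof -
  show config: "bouquet_config A G C bs"
    using assms(2) by (simp add: robust_def bouquet_config_def)
  show len: "length bs = dim_col T" using assms(2) by (simp add: robust_def)
  have "(toric_ideal (A * C) :: 'k mpoly set) = toric_ideal T"
    using assms by (simp add: robust_def bouquet_matrix_def)
  then have "mat_kernel (A * C) = mat_kernel T"
    by (rule toric_ideal_determines_kernel)
      (use bouquet_config.dim_C(2)[OF config] len in simp)
  then show "bouquet_config.bouquet_kernel A C = mat_kernel T"
    by (simp add: bouquet_config.bouquet_kernel_def[OF config])
  show "bouquet_config.nonmixed G bs = \<omega>"
    using assms(2) by (simp add: robust_def bouquet_config.nonmixed_def[OF config])
qed

text \<open>
  Both matrices see the same boxes, since these depend on \<open>\<omega>\<close> and the dimension of \<open>T\<close> only: a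
  fibre of \<open>A2\<close> is a box, and this box is also a fibre of \<open>A1\<close>.
\<close>

lemma robust_markov_basis_transfer:
  fixes I :: "'k::field mpoly set"
  assumes I: "I = toric_ideal T"
    and r1: "robust I (dim_col T) \<omega> A1 G1 bs1 C1"
    and r2: "robust I (dim_col T) \<omega> A2 G2 bs2 C2"
    and N: "N \<subseteq> mat_kernel T"
    and markov: "markov_basis A1 ((*\<^sub>v) C1 ` N)"
  shows "markov_basis A2 ((*\<^sub>v) C2 ` N)"
proof -
  note c1 = robust_bouquet_map[OF I r1] and c2 = robust_bouquet_map[OF I r2]
  interpret b1: bouquet_config A1 G1 C1 bs1 by (rule c1(1))
  interpret b2: bouquet_config A2 G2 C2 bs2 by (rule c2(1))
  show ?thesis
  proof (rule markov_basis_transfer[OF _ _ _ _ _ _ N markov])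
    show "C1 \<in> carrier_mat (dim_col A1) (dim_col T)" "C2 \<in> carrier_mat (dim_col A2) (dim_col T)"
      using b1.C_carrier b2.C_carrier c1(2) c2(2) by simp_all
    show "(*\<^sub>v) C1 ` mat_kernel T = mat_kernel A1" "(*\<^sub>v) C2 ` mat_kernel T = mat_kernel A2"
      using b1.bouquet_map_image b2.bouquet_map_image c1(3) c2(3) by simp_all
    show "inj_on ((*\<^sub>v) C1) (mat_kernel T)"
      using inj_on_subset[OF b1.bouquet_map_inj b1.bouquet_kernel_carrier] c1(3) by simp
    fix w2 assume "w2 \<in> nat_vecs (dim_col A2)"
    then obtain p q where pq: "\<forall>i<dim_col T. 0 \<le> p i \<and> 0 \<le> q i"
      and box2: "\<forall>u\<in>mat_kernel T.
        w2 - C2 *\<^sub>v u \<in> nat_vecs (dim_col A2) \<longleftrightarrow> in_box (dim_col T) \<omega> p q u"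
      using b2.feasible_set_is_box unfolding c2 by blast
    then obtain w1 where "w1 \<in> nat_vecs (dim_col A1)"
      and "\<forall>u\<in>mat_kernel T.
        w1 - C1 *\<^sub>v u \<in> nat_vecs (dim_col A1) \<longleftrightarrow> in_box (dim_col T) \<omega> p q u"
      using b1.box_is_feasible_set unfolding c1 by blast
    then show "\<exists>w1\<in>nat_vecs (dim_col A1). \<forall>u\<in>mat_kernel T.
        w1 - C1 *\<^sub>v u \<in> nat_vecs (dim_col A1) \<longleftrightarrow> w2 - C2 *\<^sub>v u \<in> nat_vecs (dim_col A2)"
      using box2 by blast
  qed
qed

theorem theorem2p2:
  fixes T A1 A2 G1 G2 C1 C2 :: "int mat"
    and bs1 bs2 :: "nat list list"
    and \<omega> :: "nat set"
    and I :: "'k::field mpoly set"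
  assumes "simple_toric T" and "I = toric_ideal T"
    and "\<omega> \<subseteq> {..<dim_col T}"
    and "mat_kernel A1 \<inter> nat_vecs (dim_col A1) = {0\<^sub>v (dim_col A1)}"
    and "mat_kernel A2 \<inter> nat_vecs (dim_col A2) = {0\<^sub>v (dim_col A2)}"
    and "robust I (dim_col T) \<omega> A1 G1 bs1 C1"
    and "robust I (dim_col T) \<omega> A2 G2 bs2 C2"
  shows "(\<forall>M1\<in>minimal_markov_bases A1.
            {bouquet_map C2 u | u. u \<in> mat_kernel T \<and> bouquet_map C1 u \<in> M1}
              \<in> minimal_markov_bases A2)
    \<and> bij_betw (transfer T C1 C2) (minimal_markov_bases A1) (minimal_markov_bases A2)
    \<and> bij_betw ((`) (transfer T C1 C2))
        ((`) sign_class ` minimal_markov_bases A1) ((`) sign_class ` minimal_markov_bases A2)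
    \<and> bij_betw (transfer T C1 C2) (indispensable_elements A1) (indispensable_elements A2)
    \<and> bij_betw (transfer T C1 C2) (universal_markov_basis A1) (universal_markov_basis A2)"
proof -
  let ?L = "mat_kernel T" and ?K1 = "mat_kernel A1" and ?K2 = "mat_kernel A2"
  note r1 = assms(6) and r2 = assms(7)
  note c1 = robust_bouquet_map[OF assms(2) r1] and c2 = robust_bouquet_map[OF assms(2) r2]
  interpret b1: bouquet_config A1 G1 C1 bs1 by (rule c1(1))
  interpret b2: bouquet_config A2 G2 C2 bs2 by (rule c2(1))
  have D1: "bij_betw ((*\<^sub>v) C1) ?L ?K1"
    using inj_on_subset[OF b1.bouquet_map_inj b1.bouquet_kernel_carrier] b1.bouquet_map_image c1(3)
    by (simp add: bij_betw_def)
  have D2: "bij_betw ((*\<^sub>v) C2) ?L ?K2"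
    using inj_on_subset[OF b2.bouquet_map_inj b2.bouquet_kernel_carrier] b2.bouquet_map_image c2(3)
    by (simp add: bij_betw_def)
  define \<phi> where "\<phi> = (*\<^sub>v) C2 \<circ> inv_into ?L ((*\<^sub>v) C1)"
  have \<phi>_D1: "\<phi> (C1 *\<^sub>v u) = C2 *\<^sub>v u" if "u \<in> ?L" for u
    using that D1 by (simp add: \<phi>_def bij_betw_inv_into_left)
  have \<phi>_image: "\<phi> ` (*\<^sub>v) C1 ` N = (*\<^sub>v) C2 ` N" if "N \<subseteq> ?L" for N
    unfolding image_image using that \<phi>_D1 by (intro image_cong) auto
  have preimage: "\<exists>N\<subseteq>?L. X = (*\<^sub>v) C1 ` N" if "X \<subseteq> ?K1" for X
    using that D1 by (metis bij_betw_def subset_imageE)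
  have \<phi>: "bij_betw \<phi> ?K1 ?K2"
    unfolding \<phi>_def by (rule bij_betw_trans[OF bij_betw_inv_into[OF D1] D2])
  have uminus: "\<phi> (- v) = - \<phi> v" if "v \<in> ?K1" for v
  proof -
    obtain u where u: "u \<in> ?L" "v = C1 *\<^sub>v u" using \<open>v \<in> ?K1\<close> D1 by (auto simp: bij_betw_def)
    then have "u \<in> carrier_vec (dim_col T)" by (simp add: mat_kernel_def)
    then have "- v = C1 *\<^sub>v (- u)" "C2 *\<^sub>v (- u) = - (C2 *\<^sub>v u)"
      using mult_mat_vec_uminus[OF b1.C_carrier] mult_mat_vec_uminus[OF b2.C_carrier] u(2) c1(2) c2(2)
      by simp_all
    then show ?thesis using \<phi>_D1 u mat_kernel_uminus by metis
  qed
  have markov: "markov_basis A1 M \<longleftrightarrow> markov_basis A2 (\<phi> ` M)" if M: "M \<subseteq> ?K1" for M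
  proof -
    obtain N where N: "N \<subseteq> ?L" "M = (*\<^sub>v) C1 ` N" using preimage[OF M] by blast
    show ?thesis
      unfolding N(2) \<phi>_image[OF N(1)]
      using robust_markov_basis_transfer[OF assms(2) r1 r2 N(1)]
        robust_markov_basis_transfer[OF assms(2) r2 r1 N(1)] by blast
  qed
  have \<tau>: "transfer T C1 C2 X = \<phi> ` X" if X: "X \<subseteq> ?K1" for X
  proof -
    obtain N where N: "N \<subseteq> ?L" "X = (*\<^sub>v) C1 ` N" using preimage[OF X] by blast
    have "C1 *\<^sub>v u \<in> X \<longleftrightarrow> u \<in> N" if "u \<in> ?L" for u
      unfolding N(2) using that N(1) D1 by (intro inj_on_image_mem_iff) (auto simp: bij_betw_def)
    then have "transfer T C1 C2 X = (*\<^sub>v) C2 ` N"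
      using N(1) unfolding transfer_def bouquet_map_def by blast
    then show ?thesis unfolding N(2) \<phi>_image[OF N(1)] .
  qed
  note facts = \<phi> uminus markov \<tau>
  have bases: "bij_betw (transfer T C1 C2) (minimal_markov_bases A1) (minimal_markov_bases A2)"
    by (rule transfer_minimal_bases[OF facts])
  moreover have "\<forall>M1\<in>minimal_markov_bases A1.
      {bouquet_map C2 u | u. u \<in> ?L \<and> bouquet_map C1 u \<in> M1} \<in> minimal_markov_bases A2"
    using bij_betwE[OF bases] unfolding transfer_def .
  ultimately show ?thesis
    using transfer_sign_class_bases[OF facts] transfer_indispensable[OF facts]
      transfer_universal[OF facts] by blast
qed

end
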